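(* Let $\Omega\subset\mathbb{C}$ be a $\mathcal{C}^\infty$ smooth bounded finitely-connected domain, and let $f$ be a function which is univalent on a neighborhood of $\overline{\Omega}$ and such that $f(\Omega)$ is a quadrature domain. Then there exists $\epsilon>0$ such that whenever $g$ is a holomorphic function on $\Omega$ such that $\sup_\Omega|g'-f'|<\epsilon$ and $g(\Omega)$ is a quadrature domain, the following holds: if $\varphi_t(z)=(1-t)f(z)+tg(z)$, $0\le t\le1$, is the straight-line homotopy from $f$ to $g$, then each $\varphi_t$ is biholomorphic on $\Omega$ (onto its image), and each $\varphi_t(\Omega)$ is a quadrature domain.
   Context: A domain is a nonempty connected open set. A $\mathcal{C}^\infty$ smooth bounded finitely-connected domain in $\mathbb{C}$ is a bounded domain whose boundary consists of finitely many disjoint $\mathcal{C}^\infty$ smooth simple closed curves. Univalent means holomorphic and injective. For a domain $\Omega\subset\mathbb{C}$, $H^2(\Omega)$ is the Bergman space of holomorphic functions on $\Omega$ square-integrable with respect to area measure. $\Omega$ is a quadrature domain (for $H^2$ functions) if there exist finitely many points $z_k\in\Omega$ and constants $c_{jk}$ (finitely many) with $\int_\Omega h\,dA=\sum_{j,k}c_{jk}h^{(j)}(z_k)$ for all $h\in H^2(\Omega)$. *)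

theory Defs
  imports "HOL-Complex_Analysis.Complex_Analysis"
begin

definition planar_domain :: "complex set \<Rightarrow> bool" where
  "planar_domain \<Omega> \<longleftrightarrow> open \<Omega> \<and> connected \<Omega> \<and> \<Omega> \<noteq> {}"

text \<open>The parametrisation is 1-periodic on the whole real line, so that smoothness includes
  the point where the loop closes up; \<open>simple_path\<close> and \<open>path_image\<close> look at one period.
  The derivative must not vanish, since otherwise the image could have corners or cusps.\<close>

definition smooth_simple_closed_curve :: "complex set \<Rightarrow> bool" where
  "smooth_simple_closed_curve C \<longleftrightarrow>
     (\<exists>\<gamma> :: real \<Rightarrow> complex.
        (\<forall>t. \<gamma> (t + 1) = \<gamma> t) \<and>
        (\<forall>n t. ((\<lambda>p s. vector_derivative p (at s)) ^^ n) \<gamma> differentiable (at t)) \<and>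
        (\<forall>t. vector_derivative \<gamma> (at t) \<noteq> 0) \<and>
        simple_path \<gamma> \<and> path_image \<gamma> = C)"

text \<open>No condition that the domain lie locally on one side of its boundary is needed: being
  connected and disjoint from its boundary, it lies on one side of each boundary curve.\<close>

definition smooth_bounded_domain :: "complex set \<Rightarrow> bool" where
  "smooth_bounded_domain \<Omega> \<longleftrightarrow>
     planar_domain \<Omega> \<and> bounded \<Omega> \<and>
     (\<exists>\<C>. finite \<C> \<and> pairwise disjnt \<C> \<and>
        (\<forall>C\<in>\<C>. smooth_simple_closed_curve C) \<and> frontier \<Omega> = \<Union>\<C>)"

definition univalent_on :: "(complex \<Rightarrow> complex) \<Rightarrow> complex set \<Rightarrow> bool" where
  "univalent_on f S \<longleftrightarrow> f holomorphic_on S \<and> inj_on f S"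

definition biholomorphic_onto_image :: "(complex \<Rightarrow> complex) \<Rightarrow> complex set \<Rightarrow> bool" where
  "biholomorphic_onto_image f S \<longleftrightarrow>
     f holomorphic_on S \<and> inj_on f S \<and> open (f ` S) \<and> inv_into S f holomorphic_on (f ` S)"

text \<open>Members are functions on all of \<open>\<complex>\<close>, of which only the values on \<open>\<Omega>\<close> matter.\<close>

definition bergman_space :: "complex set \<Rightarrow> (complex \<Rightarrow> complex) set" where
  "bergman_space \<Omega> =
     {h. h holomorphic_on \<Omega> \<and> set_integrable lborel \<Omega> (\<lambda>z. (norm (h z))\<^sup>2)}"

text \<open>Integrability of \<open>h\<close> is part of the quadrature identity because the Lebesgue integral
  of a non-integrable function is 0 by convention; it is automatic if \<open>\<Omega>\<close> has finite area.\<close>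

definition quadrature_domain :: "complex set \<Rightarrow> bool" where
  "quadrature_domain \<Omega> \<longleftrightarrow>
     planar_domain \<Omega> \<and>
     (\<exists>Z N (c :: nat \<Rightarrow> complex \<Rightarrow> complex). finite Z \<and> Z \<subseteq> \<Omega> \<and>
        (\<forall>h\<in>bergman_space \<Omega>. set_integrable lborel \<Omega> h \<and>
           set_lebesgue_integral lborel \<Omega> h = (\<Sum>z\<in>Z. \<Sum>j<N. c j z * (deriv ^^ j) h z)))"

end

theory Submission
  imports Defs
begin

text \<open>For an injective holomorphic \<open>F\<close> on \<open>\<Omega>\<close>, the substitution \<open>H = (h \<circ> F) F'\<close> turns the integral of
  \<open>h\<close> over \<open>F(\<Omega>)\<close> into the pairing of \<open>H\<close> with \<open>F'\<close> over \<open>\<Omega>\<close>, and it preserves finite combinations of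
  point evaluations of derivatives. So \<open>F(\<Omega>)\<close> is a quadrature domain if and only if pairing with
  \<open>F'\<close> is such a combination. This condition is linear in \<open>F'\<close>, hence it passes from \<open>f\<close> and \<open>g\<close> to
  \<open>(1 - t) f + t g\<close> as soon as the latter is injective.

  Injectivity is a perturbation argument. By compactness \<open>|f z - f w| \<ge> c |z - w|\<close> on the closure of
  \<open>\<Omega>\<close>. The domain satisfies a cone condition at every boundary point, because it lies on one side
  of each boundary curve, and therefore two nearby points are joined in \<open>\<Omega>\<close> by two segments of
  comparable total length. Hence a function on \<open>\<Omega>\<close> whose derivative is bounded by \<open>\<epsilon>\<close> is Lipschitz
  with a constant proportional to \<open>\<epsilon>\<close>, and \<open>f + t (g - f)\<close> is injective for small \<open>\<epsilon>\<close>.\<close>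

section \<open>Change of variables under conformal maps\<close>

text \<open>The change of variables theorem with a Jacobian determinant is applied on
  \<open>real^2\<close>; this map and its inverse carry sets and integrands there and back.\<close>

definition vec_of_complex :: "complex \<Rightarrow> real^2" where
  "vec_of_complex z = vector [Re z, Im z]"

definition complex_of_vec :: "real^2 \<Rightarrow> complex" where
  "complex_of_vec x = Complex (vec_nth x 1) (vec_nth x 2)"

lemma complex_of_vec_inverse [simp]: "complex_of_vec (vec_of_complex z) = z"
  by (simp add: complex_of_vec_def vec_of_complex_def)

lemma vec_of_complex_inverse [simp]: "vec_of_complex (complex_of_vec x) = x"
  by (simp add: complex_of_vec_def vec_of_complex_def vec_eq_iff forall_2)

lemma bounded_linear_complex_of_vec: "bounded_linear complex_of_vec"
  by (rule linear_conv_bounded_linear[THEN iffD1], rule linearI)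
    (simp_all add: complex_of_vec_def complex_eq_iff)

lemma bounded_linear_vec_of_complex: "bounded_linear vec_of_complex"
  by (rule linear_conv_bounded_linear[THEN iffD1], rule linearI)
    (simp_all add: vec_of_complex_def vec_eq_iff forall_2)

lemma vimage_complex_of_vec: "complex_of_vec -` T = vec_of_complex ` T"
proof -
  have "x \<in> vec_of_complex ` T" if "complex_of_vec x \<in> T" for x
    using imageI[OF that, of vec_of_complex] by simp
  then show ?thesis by auto
qed

lemma measurable_complex_of_vec [measurable]: "complex_of_vec \<in> borel_measurable borel"
  by (intro borel_measurable_continuous_onI linear_continuous_on bounded_linear_complex_of_vec)

text \<open>Lebesgue measure is determined by its values on boxes, and the coordinate map turns a
  box into a box with the same side lengths.\<close>

lemma lborel_complex_eq_distr: "(lborel :: complex measure) = distr lborel borel complex_of_vec"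
proof (rule lborel_eqI)
  fix l u :: complex
  assume le: "\<And>b. b \<in> Basis \<Longrightarrow> l \<bullet> b \<le> u \<bullet> b"
  have vim: "complex_of_vec -` box l u = box (vec_of_complex l) (vec_of_complex u)"
    by (auto simp: mem_box Basis_vec_def Basis_complex_def complex_of_vec_def
        vec_of_complex_def inner_axis forall_2)
  have "emeasure (distr lborel borel complex_of_vec) (box l u)
      = emeasure lborel (box (vec_of_complex l) (vec_of_complex u))"
    by (simp add: emeasure_distr vim)
  also have "\<dots> = (\<Prod>b\<in>Basis. (vec_of_complex u - vec_of_complex l) \<bullet> b)"
  proof (rule emeasure_lborel_box)
    have "\<forall>i. vec_nth (vec_of_complex l) i \<le> vec_nth (vec_of_complex u) i"
      using le[of 1] le[of \<i>] by (simp add: vec_of_complex_def forall_2 Basis_complex_def)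
    then show "vec_of_complex l \<bullet> b \<le> vec_of_complex u \<bullet> b" if "b \<in> Basis" for b
      using that by (auto simp: Basis_vec_def inner_axis)
  qed
  also have "(\<Prod>b\<in>Basis. (vec_of_complex u - vec_of_complex l) \<bullet> b) = (Re u - Re l) * (Im u - Im l)"
  proof -
    have B: "(Basis :: (real^2) set) = {axis 1 1, axis 2 1}"
      by (auto simp: Basis_vec_def UNIV_2)
    have "axis 1 1 \<noteq> (axis 2 1 :: real^2)"
      by (simp add: axis_eq_axis)
    then show ?thesis
      unfolding B by (simp add: inner_axis vec_of_complex_def)
  qed
  also have "\<dots> = (\<Prod>b\<in>Basis. (u - l) \<bullet> b)"
    by (simp add: Basis_complex_def)
  finally show "emeasure (distr lborel borel complex_of_vec) (box l u)
      = ennreal (\<Prod>b\<in>Basis. (u - l) \<bullet> b)" .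
qed simp

text \<open>Absolute integrability on \<open>real^2\<close> refers to the completed measure,
  \<open>set_integrable lborel\<close> to the Borel one. Borel measurability of the integrand cut
  off to \<open>T\<close> makes the two notions and the two integrals agree.\<close>

lemma integral_vec_of_complex:
  fixes k :: "complex \<Rightarrow> complex"
  assumes meas [measurable]: "(\<lambda>z. indicator T z *\<^sub>R k z) \<in> borel_measurable borel"
  shows "(\<lambda>x. vec_of_complex (k (complex_of_vec x))) absolutely_integrable_on (vec_of_complex ` T)
           \<longleftrightarrow> set_integrable lborel T k" (is ?P)
    and "set_integrable lborel T k \<Longrightarrow>
           integral (vec_of_complex ` T) (\<lambda>x. vec_of_complex (k (complex_of_vec x)))
             = vec_of_complex (set_lebesgue_integral lborel T k)"
proof -
  define m where "m = (\<lambda>z. indicator T z *\<^sub>R k z)"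
  have [measurable]: "m \<in> borel_measurable borel" using meas by (simp add: m_def)
  have [measurable]: "vec_of_complex \<in> borel_measurable borel"
    by (intro borel_measurable_continuous_onI linear_continuous_on bounded_linear_vec_of_complex)
  have ind: "indicator (vec_of_complex ` T) x *\<^sub>R vec_of_complex (k (complex_of_vec x))
        = vec_of_complex (m (complex_of_vec x))" for x
    using linear_0[OF bounded_linear.linear[OF bounded_linear_vec_of_complex]]
    by (auto simp: m_def indicator_def simp flip: vimage_complex_of_vec)
  have mm: "(\<lambda>x. vec_of_complex (m (complex_of_vec x))) \<in> borel_measurable lborel"
    by simp
  have 1: "integrable lborel m \<longleftrightarrow> integrable lborel (\<lambda>x. m (complex_of_vec x))"
    by (subst lborel_complex_eq_distr, rule integrable_distr_eq) simp_all
  have 2: "integrable lborel (\<lambda>x. m (complex_of_vec x)) \<longleftrightarrow>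
      integrable lborel (\<lambda>x. vec_of_complex (m (complex_of_vec x)))"
    using integrable_bounded_linear[OF bounded_linear_vec_of_complex, of lborel "\<lambda>x. m (complex_of_vec x)"]
      integrable_bounded_linear[OF bounded_linear_complex_of_vec, of lborel "\<lambda>x. vec_of_complex (m (complex_of_vec x))"]
    by auto
  show P: ?P
    unfolding set_integrable_def ind integrable_completion[OF mm] 2[symmetric] 1[symmetric]
    by (simp add: m_def)
  assume int: "set_integrable lborel T k"
  then have i: "integrable lborel m" by (simp add: m_def set_integrable_def)
  have "integral (vec_of_complex ` T) (\<lambda>x. vec_of_complex (k (complex_of_vec x)))
      = (LINT x:vec_of_complex ` T|lebesgue. vec_of_complex (k (complex_of_vec x)))"
    using P int by (simp add: set_lebesgue_integral_eq_integral)
  also have "\<dots> = (LINT x|lborel. vec_of_complex (m (complex_of_vec x)))"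
    unfolding set_lebesgue_integral_def ind by (rule integral_completion[OF mm])
  also have "\<dots> = vec_of_complex (LINT x|lborel. m (complex_of_vec x))"
    using i 1 by (intro integral_bounded_linear bounded_linear_vec_of_complex) simp
  also have "(LINT x|lborel. m (complex_of_vec x)) = (LINT z|lborel. m z)"
    using integral_distr[of complex_of_vec lborel borel m]
    by (simp flip: lborel_complex_eq_distr)
  finally show "integral (vec_of_complex ` T) (\<lambda>x. vec_of_complex (k (complex_of_vec x)))
             = vec_of_complex (set_lebesgue_integral lborel T k)"
    by (simp add: m_def set_lebesgue_integral_def)
qed

lemma borel_measurable_indicator_continuous_on:
  fixes h :: "complex \<Rightarrow> complex"
  assumes "open S" "continuous_on S h"
  shows "(\<lambda>z. indicator S z *\<^sub>R h z) \<in> borel_measurable borel"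
  using borel_measurable_continuous_on_indicator[OF _ assms(2)] assms(1) by simp

text \<open>The real derivative of \<open>F\<close> is multiplication by \<open>deriv F z\<close>,
  whose determinant is the squared modulus. Continuity is what is asked of \<open>h\<close>, since
  the integrands to come, squared norms and products with a conjugate, are not holomorphic.\<close>

lemma holomorphic_change_of_variables:
  fixes F h :: "complex \<Rightarrow> complex"
  assumes op: "open \<Omega>" and hol: "F holomorphic_on \<Omega>" and inj: "inj_on F \<Omega>"
    and cont: "continuous_on (F ` \<Omega>) h"
  shows "set_integrable lborel (F ` \<Omega>) h \<longleftrightarrow>
           set_integrable lborel \<Omega> (\<lambda>z. of_real ((norm (deriv F z))\<^sup>2) * h (F z))" (is ?P)
    and "set_integrable lborel (F ` \<Omega>) h \<Longrightarrow> set_lebesgue_integral lborel (F ` \<Omega>) h =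
           set_lebesgue_integral lborel \<Omega> (\<lambda>z. of_real ((norm (deriv F z))\<^sup>2) * h (F z))"
proof -
  define k where "k = (\<lambda>z. of_real ((norm (deriv F z))\<^sup>2) * h (F z))"
  define S where "S = vec_of_complex ` \<Omega>"
  define G where "G = (\<lambda>x. vec_of_complex (F (complex_of_vec x)))"
  define G' where "G' = (\<lambda>x v. vec_of_complex (deriv F (complex_of_vec x) * complex_of_vec v))"
  define f where "f = (\<lambda>x. vec_of_complex (h (complex_of_vec x)))"
  have opF: "open (F ` \<Omega>)" using open_mapping_thm3[OF hol op inj] .
  have mh: "(\<lambda>z. indicator (F ` \<Omega>) z *\<^sub>R h z) \<in> borel_measurable borel"
    by (rule borel_measurable_indicator_continuous_on[OF opF cont])
  have "continuous_on \<Omega> k" unfolding k_def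
    by (intro continuous_intros holomorphic_on_imp_continuous_on[OF holomorphic_deriv[OF hol op]]
        continuous_on_compose2[OF cont] holomorphic_on_imp_continuous_on[OF hol]) auto
  then have mk: "(\<lambda>z. indicator \<Omega> z *\<^sub>R k z) \<in> borel_measurable borel"
    by (rule borel_measurable_indicator_continuous_on[OF op])
  have "open S"
    unfolding S_def vimage_complex_of_vec[symmetric]
    using op linear_continuous_on[OF bounded_linear_complex_of_vec] open_vimage by blast
  then have S: "S \<in> sets lebesgue" by simp
  have GS: "G ` S = vec_of_complex ` F ` \<Omega>"
    by (auto simp: G_def S_def image_image)
  have der: "(G has_derivative G' x) (at x within S)" if "x \<in> S" for x
  proof -
    have "complex_of_vec x \<in> \<Omega>" using that by (auto simp: S_def)
    then have "(F has_derivative (*) (deriv F (complex_of_vec x))) (at (complex_of_vec x))"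
      using holomorphic_derivI[OF hol op] has_field_derivative_def by blast
    from has_derivative_compose[OF bounded_linear_imp_has_derivative[OF bounded_linear_complex_of_vec] this]
    have "((\<lambda>x. F (complex_of_vec x)) has_derivative
        (\<lambda>v. deriv F (complex_of_vec x) * complex_of_vec v)) (at x within S)" .
    from bounded_linear.has_derivative[OF bounded_linear_vec_of_complex this]
    show ?thesis unfolding G_def G'_def .
  qed
  have injG: "inj_on G S"
    using inj unfolding G_def S_def inj_on_def
    by (auto, metis complex_of_vec_inverse)
  have det: "\<bar>det (matrix (G' x))\<bar> = (norm (deriv F (complex_of_vec x)))\<^sup>2" for x
  proof -
    have "det (matrix (G' x)) = (norm (deriv F (complex_of_vec x)))\<^sup>2"
      unfolding cmod_power2
      by (simp add: det_2 matrix_def G'_def vec_of_complex_def complex_of_vec_def axis_def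
          power2_eq_square)
    then show ?thesis by simp
  qed
  have eq: "\<bar>det (matrix (G' x))\<bar> *\<^sub>R f (G x) = vec_of_complex (k (complex_of_vec x))" for x
    unfolding det k_def f_def G_def
    unfolding linear_cmul[OF bounded_linear.linear[OF bounded_linear_vec_of_complex], symmetric]
    by (simp add: scaleR_conv_of_real)
  note cov = has_absolute_integral_change_of_variables[OF S der injG, of f, unfolded eq GS]
  note A = integral_vec_of_complex[OF mh] and B = integral_vec_of_complex[OF mk]
  show P: ?P
    using cov A(1) B(1) unfolding f_def S_def k_def[symmetric] by metis
  assume i: "set_integrable lborel (F ` \<Omega>) h"
  have "vec_of_complex (set_lebesgue_integral lborel \<Omega> k) =
      vec_of_complex (set_lebesgue_integral lborel (F ` \<Omega>) h)"
    using cov A B i P unfolding f_def S_def k_def[symmetric] by metis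
  then show "set_lebesgue_integral lborel (F ` \<Omega>) h = set_lebesgue_integral lborel \<Omega>
       (\<lambda>z. of_real ((norm (deriv F z))\<^sup>2) * h (F z))"
    unfolding k_def[symmetric] by (metis complex_of_vec_inverse)
qed

section \<open>Pulling back quadrature identities\<close>

text \<open>Agreement is demanded for every holomorphic \<open>h\<close>, not only for Bergman
  functions: the derivative of a Bergman function need not be one, and the pullback below passes to
  derivatives.\<close>

definition point_functional :: "complex set \<Rightarrow> ((complex \<Rightarrow> complex) \<Rightarrow> complex) \<Rightarrow> bool" where
  "point_functional D L \<longleftrightarrow> (\<exists>Z N (c :: nat \<Rightarrow> complex \<Rightarrow> complex). finite Z \<and> Z \<subseteq> D \<and>
     (\<forall>h. h holomorphic_on D \<longrightarrow> L h = (\<Sum>z\<in>Z. \<Sum>j<N. c j z * (deriv ^^ j) h z)))"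

lemma point_functional_cong:
  assumes "point_functional D L" "\<And>h. h holomorphic_on D \<Longrightarrow> L' h = L h"
  shows "point_functional D L'"
  using assms unfolding point_functional_def by simp

lemma point_functional_add:
  assumes "point_functional D L1" "point_functional D L2"
  shows "point_functional D (\<lambda>h. L1 h + L2 h)"
proof -
  obtain Z1 N1 c1 where 1: "finite Z1" "Z1 \<subseteq> D"
    "\<And>h. h holomorphic_on D \<Longrightarrow> L1 h = (\<Sum>z\<in>Z1. \<Sum>j<(N1::nat). c1 j z * (deriv ^^ j) h z)"
    using assms(1) unfolding point_functional_def by blast
  obtain Z2 N2 c2 where 2: "finite Z2" "Z2 \<subseteq> D"
    "\<And>h. h holomorphic_on D \<Longrightarrow> L2 h = (\<Sum>z\<in>Z2. \<Sum>j<(N2::nat). c2 j z * (deriv ^^ j) h z)"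
    using assms(2) unfolding point_functional_def by blast
  \<comment> \<open>Padding with zero coefficients makes both sums run over the same points and the
    same orders of derivative.\<close>
  define e where "e = (\<lambda>Z N (c::nat \<Rightarrow> complex \<Rightarrow> complex) j z. if z \<in> Z \<and> j < N then c j z else 0)"
  have extend: "(\<Sum>z\<in>Z. \<Sum>j<N. c j z * (deriv ^^ j) h z) =
      (\<Sum>z\<in>Z'. \<Sum>j<N'. e Z N c j z * (deriv ^^ j) h z)"
    if "finite Z'" "Z \<subseteq> Z'" "N \<le> N'" for Z Z' N N' c h
    unfolding sum.cartesian_product using that
    by (intro sum.mono_neutral_cong_left) (auto simp: e_def split: if_splits)
  show ?thesis
    unfolding point_functional_def
  proof (intro exI conjI allI impI)
    show "finite (Z1 \<union> Z2)" "Z1 \<union> Z2 \<subseteq> D" using 1 2 by auto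
    fix h assume h: "h holomorphic_on D"
    show "L1 h + L2 h = (\<Sum>z\<in>Z1 \<union> Z2. \<Sum>j<N1 + N2.
        (\<lambda>j z. e Z1 N1 c1 j z + e Z2 N2 c2 j z) j z * (deriv ^^ j) h z)"
      unfolding 1(3)[OF h] 2(3)[OF h] using 1 2
      by (simp add: extend[of "Z1 \<union> Z2" Z1 N1 "N1 + N2" c1 h]
          extend[of "Z1 \<union> Z2" Z2 N2 "N1 + N2" c2 h] sum.distrib distrib_right)
  qed
qed

lemma point_functional_cmult:
  assumes "point_functional D L"
  shows "point_functional D (\<lambda>h. a * L h)"
proof -
  obtain Z N c where 1: "finite Z" "Z \<subseteq> D"
    "\<And>h. h holomorphic_on D \<Longrightarrow> L h = (\<Sum>z\<in>Z. \<Sum>j<(N::nat). c j z * (deriv ^^ j) h z)"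
    using assms unfolding point_functional_def by blast
  show ?thesis
    unfolding point_functional_def using 1
    by (intro exI[of _ Z] exI[of _ N] exI[of _ "\<lambda>j z. a * c j z"])
      (auto simp: sum_distrib_left mult.assoc)
qed

lemma point_functional_zero: "point_functional D (\<lambda>h. 0)"
  unfolding point_functional_def by (intro exI[of _ "{}"]) simp

lemma point_functional_sum:
  assumes "\<And>i. i \<in> I \<Longrightarrow> point_functional D (L i)"
  shows "point_functional D (\<lambda>h. \<Sum>i\<in>I. L i h)"
  using assms
  by (induction I rule: infinite_finite_induct)
    (auto intro: point_functional_zero point_functional_add)

lemma point_functional_eval:
  assumes "z \<in> D"
  shows "point_functional D (\<lambda>h. h z)"
  unfolding point_functional_def using assms
  by (intro exI[of _ "{z}"] exI[of _ "1::nat"] exI[of _ "\<lambda>_ _. 1"]) simp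

lemma point_functional_deriv:
  assumes "open D" "point_functional D L"
  shows "point_functional D (\<lambda>h. L (deriv h))"
proof -
  obtain Z N c where 1: "finite Z" "Z \<subseteq> D"
    "\<And>h. h holomorphic_on D \<Longrightarrow> L h = (\<Sum>z\<in>Z. \<Sum>j<(N::nat). c j z * (deriv ^^ j) h z)"
    using assms(2) unfolding point_functional_def by blast
  show ?thesis
    unfolding point_functional_def using 1
  \<comment> \<open>All coefficients move up by one order. The case \<open>j = 0\<close> is set
    apart because \<open>j - 1\<close> is 0 there on natural numbers.\<close>
  proof (intro exI[of _ Z] exI[of _ "Suc N"] exI[of _ "\<lambda>j z. if j = 0 then 0 else c (j - 1) z"]
      conjI allI impI)
    fix h assume "h holomorphic_on D"
    then show "L (deriv h) = (\<Sum>z\<in>Z. \<Sum>j<Suc N. (if j = 0 then 0 else c (j - 1) z) * (deriv ^^ j) h z)"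
      by (subst 1(3)) (auto intro: holomorphic_deriv assms(1)
          simp: sum.lessThan_Suc_shift funpow_Suc_right simp del: funpow.simps sum.lessThan_Suc)
  qed
qed

text \<open>Differentiating \<open>Q w * H (G w)\<close> once gives two terms of the same shape: one
  pairs \<open>deriv Q\<close> with \<open>H\<close>, the other \<open>Q w * deriv G w\<close> with
  \<open>deriv H\<close>. The induction on \<open>j\<close> therefore runs over all \<open>Q\<close>
  at once.\<close>

lemma point_functional_pullback_deriv:
  assumes "open D" "open \<Omega>" "G holomorphic_on D" "G ` D \<subseteq> \<Omega>" "w \<in> D"
  assumes "Q holomorphic_on D"
  shows "point_functional \<Omega> (\<lambda>H. (deriv ^^ j) (\<lambda>w. Q w * H (G w)) w)"
  using assms(6)
proof (induction j arbitrary: Q)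
  case 0
  have "G w \<in> \<Omega>" using assms by auto
  then show ?case
    using point_functional_cmult[OF point_functional_eval] by simp
next
  case (Suc j)
  have d: "deriv Q holomorphic_on D" "deriv G holomorphic_on D"
    using Suc.prems assms holomorphic_deriv by blast+
  define L where "L = (\<lambda>H. (deriv ^^ j) (\<lambda>w. deriv Q w * H (G w)) w +
      (deriv ^^ j) (\<lambda>w. (Q w * deriv G w) * deriv H (G w)) w)"
  have "point_functional \<Omega> L"
    unfolding L_def
  proof (rule point_functional_add)
    show "point_functional \<Omega> (\<lambda>H. (deriv ^^ j) (\<lambda>w. deriv Q w * H (G w)) w)"
      using Suc.IH d by blast
    have "point_functional \<Omega> (\<lambda>H. (deriv ^^ j) (\<lambda>w. (Q w * deriv G w) * H (G w)) w)"
      by (intro Suc.IH holomorphic_intros d Suc.prems)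
    then show "point_functional \<Omega> (\<lambda>H. (deriv ^^ j) (\<lambda>w. (Q w * deriv G w) * deriv H (G w)) w)"
      using point_functional_deriv[OF assms(2)] by blast
  qed
  then show ?case
  proof (rule point_functional_cong)
    fix H assume H: "H holomorphic_on \<Omega>"
    have dH: "deriv H holomorphic_on \<Omega>" using H assms holomorphic_deriv by blast
    have comp: "(\<lambda>w. K (G w)) holomorphic_on D" if "K holomorphic_on \<Omega>" for K
      using holomorphic_on_compose_gen[OF assms(3) that assms(4)] by (simp add: o_def)
    have "(deriv ^^ Suc j) (\<lambda>w. Q w * H (G w)) w = (deriv ^^ j) (deriv (\<lambda>w. Q w * H (G w))) w"
      by (simp add: funpow_Suc_right del: funpow.simps)
    also have "\<dots> = (deriv ^^ j) (\<lambda>w. deriv Q w * H (G w) + (Q w * deriv G w) * deriv H (G w)) w"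
    proof (rule higher_deriv_cong_ev)
      have "deriv (\<lambda>w. Q w * H (G w)) x = deriv Q x * H (G x) + (Q x * deriv G x) * deriv H (G x)"
        if x: "x \<in> D" for x
      proof (rule DERIV_imp_deriv)
        have "G x \<in> \<Omega>" using x assms by auto
        then show "((\<lambda>w. Q w * H (G w)) has_field_derivative
            deriv Q x * H (G x) + (Q x * deriv G x) * deriv H (G x)) (at x)"
          by (auto intro!: derivative_eq_intros holomorphic_derivI[OF Suc.prems \<open>open D\<close> x]
              DERIV_chain2[OF holomorphic_derivI[OF H assms(2)] holomorphic_derivI[OF assms(3,1) x]])
      qed
      then show "\<forall>\<^sub>F x in nhds w. deriv (\<lambda>w. Q w * H (G w)) x =
          deriv Q x * H (G x) + (Q x * deriv G x) * deriv H (G x)"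
        using assms(1,5) eventually_nhds by blast
    qed simp
    also have "\<dots> = L H"
      unfolding L_def using assms(1,5)
      by (intro higher_deriv_add[where S = D] holomorphic_intros comp d Suc.prems assms H dH)
    finally show "(deriv ^^ Suc j) (\<lambda>w. Q w * H (G w)) w = L H" .
  qed
qed

lemma point_functional_pullback:
  assumes "open D" "open \<Omega>" "G holomorphic_on D" "G ` D \<subseteq> \<Omega>" "Q holomorphic_on D"
    and "point_functional D L"
  shows "point_functional \<Omega> (\<lambda>H. L (\<lambda>w. Q w * H (G w)))"
proof -
  obtain Z N c where 1: "finite Z" "Z \<subseteq> D"
    "\<And>h. h holomorphic_on D \<Longrightarrow> L h = (\<Sum>z\<in>Z. \<Sum>j<(N::nat). c j z * (deriv ^^ j) h z)"
    using assms(6) unfolding point_functional_def by blast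
  have "point_functional \<Omega> (\<lambda>H. \<Sum>z\<in>Z. \<Sum>j<N. c j z * (deriv ^^ j) (\<lambda>w. Q w * H (G w)) z)"
    using 1(2) assms
    by (intro point_functional_sum point_functional_cmult point_functional_pullback_deriv) auto
  then show ?thesis
  proof (rule point_functional_cong)
    fix H assume "H holomorphic_on \<Omega>"
    then have "(\<lambda>w. Q w * H (G w)) holomorphic_on D"
      using holomorphic_on_compose_gen[OF assms(3) _ assms(4)] assms(5)
      by (auto intro!: holomorphic_intros simp: o_def)
    then show "L (\<lambda>w. Q w * H (G w)) =
        (\<Sum>z\<in>Z. \<Sum>j<N. c j z * (deriv ^^ j) (\<lambda>w. Q w * H (G w)) z)"
      by (rule 1(3))
  qed
qed

section \<open>Weights on a fixed domain in place of varying domains\<close>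

text \<open>\<open>quadrature_weight D \<psi>\<close> says that pairing with \<open>\<psi>\<close> in the Bergman space of \<open>D\<close> is a finite
  combination of point evaluations of derivatives; in the classical formulation, that \<open>\<psi>\<close> lies in
  the Bergman span of \<open>D\<close>.\<close>

definition quadrature_weight :: "complex set \<Rightarrow> (complex \<Rightarrow> complex) \<Rightarrow> bool" where
  "quadrature_weight D \<psi> \<longleftrightarrow> (\<exists>L. point_functional D L \<and>
     (\<forall>h\<in>bergman_space D. set_integrable lborel D (\<lambda>z. h z * cnj (\<psi> z)) \<and>
        set_lebesgue_integral lborel D (\<lambda>z. h z * cnj (\<psi> z)) = L h))"

lemma quadrature_domain_iff:
  "quadrature_domain D \<longleftrightarrow> planar_domain D \<and> quadrature_weight D (\<lambda>_. 1)"
proof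
  assume "quadrature_domain D"
  then obtain Z N and c :: "nat \<Rightarrow> complex \<Rightarrow> complex" where "planar_domain D" and Z: "finite Z" "Z \<subseteq> D"
    and h: "\<forall>h\<in>bergman_space D. set_integrable lborel D h \<and>
      set_lebesgue_integral lborel D h = (\<Sum>z\<in>Z. \<Sum>j<N. c j z * (deriv ^^ j) h z)"
    unfolding quadrature_domain_def by blast
  then show "planar_domain D \<and> quadrature_weight D (\<lambda>_. 1)"
    unfolding quadrature_weight_def point_functional_def
    by (intro conjI exI[of _ "\<lambda>h. \<Sum>z\<in>Z. \<Sum>j<N. c j z * (deriv ^^ j) h z"]
        exI[of _ Z] exI[of _ N] exI[of _ c]) auto
next
  assume R: "planar_domain D \<and> quadrature_weight D (\<lambda>_. 1)"
  then obtain L where L: "point_functional D L"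
    and h: "\<And>h. h \<in> bergman_space D \<Longrightarrow> set_integrable lborel D h \<and>
      set_lebesgue_integral lborel D h = L h"
    unfolding quadrature_weight_def by auto
  obtain Z N and c :: "nat \<Rightarrow> complex \<Rightarrow> complex" where 1: "finite Z" "Z \<subseteq> D"
    "\<And>h. h holomorphic_on D \<Longrightarrow> L h = (\<Sum>z\<in>Z. \<Sum>j<N. c j z * (deriv ^^ j) h z)"
    using L unfolding point_functional_def by blast
  show "quadrature_domain D"
    unfolding quadrature_domain_def
    using R 1 h by (intro conjI exI[of _ Z] exI[of _ N] exI[of _ c]) (auto simp: bergman_space_def)
qed

lemma quadrature_weight_cong:
  assumes "open D" "quadrature_weight D \<psi>" "\<And>z. z \<in> D \<Longrightarrow> \<psi>' z = \<psi> z"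
  shows "quadrature_weight D \<psi>'"
proof -
  have "set_integrable lborel D (\<lambda>z. h z * cnj (\<psi>' z)) = set_integrable lborel D (\<lambda>z. h z * cnj (\<psi> z))" for h
    by (rule set_integrable_cong) (simp_all add: assms(3))
  moreover have "set_lebesgue_integral lborel D (\<lambda>z. h z * cnj (\<psi>' z)) =
         set_lebesgue_integral lborel D (\<lambda>z. h z * cnj (\<psi> z))" for h
    by (rule set_lebesgue_integral_cong) (simp_all add: assms(1,3))
  ultimately show ?thesis using assms(2) unfolding quadrature_weight_def by simp
qed

text \<open>Conjugation leaves real coefficients alone, and the homotopy parameter is real.\<close>

lemma quadrature_weight_add_real:
  fixes a b :: real
  assumes "quadrature_weight D \<psi>1" "quadrature_weight D \<psi>2"
  shows "quadrature_weight D (\<lambda>z. of_real a * \<psi>1 z + of_real b * \<psi>2 z)"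
proof -
  obtain L1 where L1: "point_functional D L1" "\<And>h. h \<in> bergman_space D \<Longrightarrow>
      set_integrable lborel D (\<lambda>z. h z * cnj (\<psi>1 z)) \<and>
      set_lebesgue_integral lborel D (\<lambda>z. h z * cnj (\<psi>1 z)) = L1 h"
    using assms(1) unfolding quadrature_weight_def by blast
  obtain L2 where L2: "point_functional D L2" "\<And>h. h \<in> bergman_space D \<Longrightarrow>
      set_integrable lborel D (\<lambda>z. h z * cnj (\<psi>2 z)) \<and>
      set_lebesgue_integral lborel D (\<lambda>z. h z * cnj (\<psi>2 z)) = L2 h"
    using assms(2) unfolding quadrature_weight_def by blast
  have eq: "h z * cnj (of_real a * \<psi>1 z + of_real b * \<psi>2 z) =
      of_real a * (h z * cnj (\<psi>1 z)) + of_real b * (h z * cnj (\<psi>2 z))" for h z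
    by (simp add: algebra_simps)
  show ?thesis
    unfolding quadrature_weight_def eq using L1 L2
    by (intro exI[of _ "\<lambda>h. of_real a * L1 h + of_real b * L2 h"] conjI ballI
        point_functional_add point_functional_cmult) auto
qed

text \<open>With \<open>G\<close> inverse to \<open>F\<close>, the rule
  \<open>h w = deriv G w * H (G w)\<close> carries Bergman functions on \<Omega> isometrically to
  Bergman functions on the image. A general \<psi> is allowed so that the lemma applies to
  \<open>F\<close> and to \<open>G\<close> alike.\<close>

lemma quadrature_weight_transfer:
  assumes op: "open \<Omega>" and hol: "F holomorphic_on \<Omega>" and inj: "inj_on F \<Omega>"
    and psi: "continuous_on (F ` \<Omega>) \<psi>" and qw: "quadrature_weight (F ` \<Omega>) \<psi>"
  shows "quadrature_weight \<Omega> (\<lambda>z. \<psi> (F z) * deriv F z)"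
proof -
  define D where "D = F ` \<Omega>"
  have opD: "open D" unfolding D_def using open_mapping_thm3[OF hol op inj] .
  obtain G where G: "G holomorphic_on D" "\<And>z. z \<in> \<Omega> \<Longrightarrow> deriv F z * deriv G (F z) = 1"
    "\<And>z. z \<in> \<Omega> \<Longrightarrow> G (F z) = z"
    using holomorphic_has_inverse[OF hol op inj] unfolding D_def by blast
  have GD: "G ` D \<subseteq> \<Omega>" using G(3) by (auto simp: D_def)
  have dG: "deriv G holomorphic_on D" using G(1) opD holomorphic_deriv by blast
  obtain L where L: "point_functional D L" "\<And>h. h \<in> bergman_space D \<Longrightarrow>
      set_integrable lborel D (\<lambda>z. h z * cnj (\<psi> z)) \<and>
      set_lebesgue_integral lborel D (\<lambda>z. h z * cnj (\<psi> z)) = L h"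
    using qw unfolding quadrature_weight_def D_def by blast
  show ?thesis
    unfolding quadrature_weight_def
  proof (intro exI conjI ballI)
    show "point_functional \<Omega> (\<lambda>H. L (\<lambda>w. deriv G w * H (G w)))"
      by (rule point_functional_pullback[OF opD op G(1) GD dG L(1)])
    fix H assume "H \<in> bergman_space \<Omega>"
    then have H: "H holomorphic_on \<Omega>" "set_integrable lborel \<Omega> (\<lambda>z. (norm (H z))\<^sup>2)"
      by (auto simp: bergman_space_def)
    define h where "h = (\<lambda>w. deriv G w * H (G w))"
    have hh: "h holomorphic_on D"
      unfolding h_def using holomorphic_on_compose_gen[OF G(1) H(1) GD] dG
      by (auto intro!: holomorphic_intros simp: o_def)
    note ch = holomorphic_on_imp_continuous_on[OF hh]
    \<comment> \<open>Square integrability of \<open>h\<close>, written with complex values to fit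
      the change of variables. The squared norms match because
      \<open>deriv F z * h (F z) = H z\<close>.\<close>
    have "set_integrable lborel D (\<lambda>w. (of_real ((norm (h w))\<^sup>2) :: complex)) \<longleftrightarrow>
        set_integrable lborel \<Omega> (\<lambda>z. of_real ((norm (deriv F z))\<^sup>2) * of_real ((norm (h (F z)))\<^sup>2) :: complex)"
      unfolding D_def
      by (rule holomorphic_change_of_variables[OF op hol inj])
        (intro continuous_intros ch[unfolded D_def])
    also have "\<dots> \<longleftrightarrow> set_integrable lborel \<Omega> (\<lambda>z. of_real ((norm (H z))\<^sup>2) :: complex)"
    proof (rule set_integrable_cong)
      fix z assume "z \<in> \<Omega>"
      then have "deriv F z * h (F z) = H z"
        using G by (simp add: h_def flip: mult.assoc)
      then have "norm (deriv F z) * norm (h (F z)) = norm (H z)"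
        unfolding norm_mult[symmetric] by simp
      then show "of_real ((norm (deriv F z))\<^sup>2) * of_real ((norm (h (F z)))\<^sup>2) = (of_real ((norm (H z))\<^sup>2) :: complex)"
        unfolding of_real_mult[symmetric] power_mult_distrib[symmetric] by simp
    qed auto
    finally have "h \<in> bergman_space D"
      using hh H(2) unfolding bergman_space_def set_integrable_def
      by (simp add: complex_of_real_integrable_eq scaleR_conv_of_real flip: of_real_mult of_real_power)
    note Lh = L(2)[OF this]
    \<comment> \<open>Of the two factors in \<open>deriv F z * cnj (deriv F z)\<close>, the first
      turns \<open>h (F z)\<close> into \<open>H z\<close> and the second joins the weight.\<close>
    have eq: "of_real ((norm (deriv F z))\<^sup>2) * (h (F z) * cnj (\<psi> (F z))) = H z * cnj (\<psi> (F z) * deriv F z)"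
      if "z \<in> \<Omega>" for z
    proof -
      have "deriv F z * h (F z) = H z"
        using G that by (simp add: h_def flip: mult.assoc)
      then show ?thesis
        unfolding complex_norm_square by (simp add: mult_ac flip: \<open>deriv F z * h (F z) = H z\<close>)
    qed
    have cont: "continuous_on (F ` \<Omega>) (\<lambda>w. h w * cnj (\<psi> w))"
      by (intro continuous_intros ch[unfolded D_def] psi)
    note cov = holomorphic_change_of_variables[OF op hol inj cont, folded D_def]
    show "set_integrable lborel \<Omega> (\<lambda>z. H z * cnj (\<psi> (F z) * deriv F z))"
    proof -
      have "set_integrable lborel \<Omega> (\<lambda>z. of_real ((norm (deriv F z))\<^sup>2) * (h (F z) * cnj (\<psi> (F z)))) \<longleftrightarrow>
          set_integrable lborel \<Omega> (\<lambda>z. H z * cnj (\<psi> (F z) * deriv F z))"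
        by (rule set_integrable_cong[OF refl refl eq])
      then show ?thesis using cov(1) Lh by simp
    qed
    have "set_lebesgue_integral lborel \<Omega> (\<lambda>z. H z * cnj (\<psi> (F z) * deriv F z)) =
        set_lebesgue_integral lborel \<Omega> (\<lambda>z. of_real ((norm (deriv F z))\<^sup>2) * (h (F z) * cnj (\<psi> (F z))))"
      using op by (intro set_lebesgue_integral_cong allI impI eq[symmetric]) simp_all
    also have "\<dots> = L h" using cov(2) Lh by simp
    finally show "set_lebesgue_integral lborel \<Omega> (\<lambda>z. H z * cnj (\<psi> (F z) * deriv F z)) =
        L (\<lambda>w. deriv G w * H (G w))" by (simp add: h_def)
  qed
qed

text \<open>Forwards, transfer along \<open>F\<close> with weight 1. Backwards, transfer along the
  inverse \<open>G\<close> with weight \<open>deriv F\<close>; the resulting weight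
  \<open>deriv F (G w) * deriv G w\<close> is 1 on the image.\<close>

lemma quadrature_domain_image_iff:
  assumes dom: "planar_domain \<Omega>" and hol: "F holomorphic_on \<Omega>" and inj: "inj_on F \<Omega>"
  shows "quadrature_domain (F ` \<Omega>) \<longleftrightarrow> quadrature_weight \<Omega> (deriv F)"
proof -
  have op: "open \<Omega>" using dom by (simp add: planar_domain_def)
  have opD: "open (F ` \<Omega>)" using open_mapping_thm3[OF hol op inj] .
  then have pl: "planar_domain (F ` \<Omega>)"
    using dom connected_continuous_image[OF holomorphic_on_imp_continuous_on[OF hol]]
    by (simp add: planar_domain_def)
  obtain G where G: "G holomorphic_on F ` \<Omega>" "\<And>z. z \<in> \<Omega> \<Longrightarrow> deriv F z * deriv G (F z) = 1"
    "\<And>z. z \<in> \<Omega> \<Longrightarrow> G (F z) = z"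
    using holomorphic_has_inverse[OF hol op inj] by metis
  have GD: "G ` F ` \<Omega> = \<Omega>" using G(3) by (auto simp: image_iff)
  have injG: "inj_on G (F ` \<Omega>)" using G(3) by (auto simp: inj_on_def)
  have "quadrature_weight (F ` \<Omega>) (\<lambda>_. 1) \<longleftrightarrow> quadrature_weight \<Omega> (deriv F)"
  proof
    assume "quadrature_weight (F ` \<Omega>) (\<lambda>_. 1)"
    from quadrature_weight_transfer[OF op hol inj _ this]
    show "quadrature_weight \<Omega> (deriv F)" by simp
  next
    assume "quadrature_weight \<Omega> (deriv F)"
    with quadrature_weight_transfer[OF opD G(1) injG, of "deriv F"]
    have "quadrature_weight (F ` \<Omega>) (\<lambda>w. deriv F (G w) * deriv G w)"
      using holomorphic_on_imp_continuous_on[OF holomorphic_deriv[OF hol op]] by (simp add: GD)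
    then show "quadrature_weight (F ` \<Omega>) (\<lambda>_. 1)"
      by (rule quadrature_weight_cong[OF opD]) (use G in auto)
  qed
  then show ?thesis using pl by (simp add: quadrature_domain_iff)
qed

section \<open>The cone condition for smooth domains\<close>

lemma periodic_of_int:
  fixes \<gamma> :: "real \<Rightarrow> 'a"
  assumes "\<And>t. \<gamma> (t + 1) = \<gamma> t"
  shows "\<gamma> (t + of_int n) = \<gamma> t"
proof -
  have nat: "\<gamma> (t + of_nat m) = \<gamma> t" for t m
  proof (induction m)
    case (Suc m)
    then show ?case using assms[of "t + of_nat m"] by (simp add: algebra_simps)
  qed simp
  show ?thesis
  proof (cases "n \<ge> 0")
    case True
    then show ?thesis using nat[of t "nat n"] by simp
  next
    case False
    then show ?thesis using nat[of "t + of_int n" "nat (- n)"] by simp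
  qed
qed

text \<open>In coordinates where the tangent direction \<open>T\<close> at \<open>p\<close> is the real axis, chords of the curve
  are nearly horizontal and nearest-point normals are nearly vertical.\<close>

lemma smooth_curve_local:
  assumes "smooth_simple_closed_curve C" "p \<in> C"
  obtains T R where "T \<noteq> 0" "R > 0"
    "\<And>q q'. \<lbrakk>q \<in> C; q' \<in> C; q \<in> ball p R; q' \<in> ball p R\<rbrakk>
        \<Longrightarrow> \<bar>Im ((q' - q) / T)\<bar> \<le> \<bar>Re ((q' - q) / T)\<bar> / 2"
    "\<And>q z. \<lbrakk>q \<in> C; q \<in> ball p R; \<And>y. y \<in> C \<Longrightarrow> dist z q \<le> dist z y\<rbrakk>
        \<Longrightarrow> \<bar>Re ((z - q) / T)\<bar> \<le> \<bar>Im ((z - q) / T)\<bar> / 2"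
proof -
  obtain \<gamma> :: "real \<Rightarrow> complex" where per: "\<And>t. \<gamma> (t + 1) = \<gamma> t"
    and smooth: "\<And>n t. ((\<lambda>p s. vector_derivative p (at s)) ^^ n) \<gamma> differentiable (at t)"
    and nz: "\<And>t. vector_derivative \<gamma> (at t) \<noteq> 0"
    and sp: "simple_path \<gamma>" "path_image \<gamma> = C"
    using assms(1) unfolding smooth_simple_closed_curve_def by blast
  define d where "d = (\<lambda>t. vector_derivative \<gamma> (at t))"
  have der: "(\<gamma> has_vector_derivative d t) (at t)" for t
    using smooth[of 0 t] unfolding d_def by (simp add: vector_derivative_works)
  have contd: "isCont d t" for t
    using smooth[of 1 t] unfolding d_def by (simp add: differentiable_imp_continuous_within)
  have cont\<gamma>: "continuous_on S \<gamma>" for S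
    using der by (meson continuous_at_imp_continuous_on has_vector_derivative_continuous)
  obtain t0 where t0: "\<gamma> t0 = p" using assms(2) sp(2) by (auto simp: path_image_def)
  define T where "T = d t0"
  have T: "T \<noteq> 0" using nz by (simp add: T_def d_def)
  \<comment> \<open>On this parameter interval the velocity differs from \<open>T\<close> by less
    than a quarter of its length; both slope bounds 1/2 come from this quarter.\<close>
  obtain \<delta> where \<delta>: "\<delta> > 0" "\<And>t. dist t t0 < \<delta> \<Longrightarrow> norm (d t - T) < norm T / 4"
    using contd[of t0] T unfolding continuous_at_eps_delta T_def
    by (metis dist_norm norm_not_less_zero not_less_iff_gr_or_eq zero_less_divide_iff zero_less_norm_iff zero_less_numeral)
  \<comment> \<open>A period centred at \<open>t0\<close>, so that \<open>t0\<close> is interior to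
    it even when it is an endpoint of the unit interval.\<close>
  have C_param: "\<exists>t\<in>{t0 - 1/2..t0 + 1/2}. \<gamma> t = q" if "q \<in> C" for q
  proof -
    obtain s where s: "\<gamma> s = q" using \<open>q \<in> C\<close> sp(2) by (auto simp: path_image_def)
    define t where "t = s + of_int (- \<lfloor>s - t0 + 1/2\<rfloor>)"
    have "\<gamma> t = q" using periodic_of_int[of \<gamma>, OF per] s unfolding t_def by metis
    moreover have "t \<in> {t0 - 1/2..t0 + 1/2}" unfolding t_def by auto linarith+
    ultimately show ?thesis by blast
  qed
  have C_image: "\<gamma> t \<in> C" for t
  proof -
    have "\<gamma> t = \<gamma> (frac t)"
      using periodic_of_int[of \<gamma> t "- \<lfloor>t\<rfloor>", OF per] by (simp add: frac_def)
    moreover have "frac t \<in> {0..1}" using frac_lt_1[of t] by (simp add: less_imp_le)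
    ultimately show ?thesis using sp(2) by (auto simp: path_image_def)
  qed
  have inj: "t = t0" if "\<gamma> t = p" "t \<in> {t0 - 1/2..t0 + 1/2}" for t
  proof -
    have fr: "\<gamma> (frac t) = \<gamma> t" for t
      using periodic_of_int[of \<gamma> t "- \<lfloor>t\<rfloor>", OF per] by (simp add: frac_def)
    have "frac t = frac t0"
      using sp(1) fr[of t] fr[of t0] that(1) t0 frac_lt_1[of t] frac_lt_1[of t0]
      unfolding simple_path_def loop_free_def
      by (metis atLeastAtMost_iff frac_ge_0 less_imp_le less_irrefl)
    then have "t - t0 = of_int (\<lfloor>t\<rfloor> - \<lfloor>t0\<rfloor>)" by (simp add: frac_def)
    moreover have "\<bar>t - t0\<bar> < 1" using that(2) by auto
    ultimately have "\<lfloor>t\<rfloor> - \<lfloor>t0\<rfloor> = 0" by linarith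
    with \<open>t - t0 = _\<close> show ?thesis by simp
  qed
  \<comment> \<open>The arcs with parameters at least \<delta> away from \<open>t0\<close> form a
    compact set, which misses \<open>p\<close> because the curve is simple. So a small ball around
    \<open>p\<close> meets the curve only at parameters near \<open>t0\<close>.\<close>
  define K where "K = \<gamma> ` ({t0 - 1/2..t0 + 1/2} - ball t0 \<delta>)"
  have "compact K" unfolding K_def
    by (intro compact_continuous_image cont\<gamma> compact_diff) auto
  moreover have "p \<notin> K"
  proof
    assume "p \<in> K"
    then obtain t where "t \<in> {t0 - 1/2..t0 + 1/2}" "t \<notin> ball t0 \<delta>" "\<gamma> t = p"
      unfolding K_def by blast
    then show False using inj[of t] \<delta>(1) by simp
  qed
  ultimately obtain R where R: "R > 0" "ball p R \<inter> K = {}"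
    using compact_imp_closed[of K] by (metis ComplI open_Compl open_contains_ball_eq disjoint_eq_subset_Compl)
  have near: "\<exists>t\<in>ball t0 \<delta>. \<gamma> t = q" if "q \<in> C" "q \<in> ball p R" for q
    using C_param[OF that(1)] that(2) R(2) unfolding K_def by blast
  show thesis
  proof (rule that[OF T R(1)])
    fix q q' assume q: "q \<in> C" "q' \<in> C" "q \<in> ball p R" "q' \<in> ball p R"
    obtain t t' where t: "t \<in> ball t0 \<delta>" "t' \<in> ball t0 \<delta>" "\<gamma> t = q" "\<gamma> t' = q'"
      using near q by metis
    have "norm (\<gamma> t' - \<gamma> t - (t' - t) *\<^sub>R d t0) \<le> norm (t' - t) * (norm T / 4)"
    proof (rule vector_differentiable_bound_linearization[where S = "ball t0 \<delta>"])
      show "closed_segment t t' \<subseteq> ball t0 \<delta>"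
        using t convex_ball closed_segment_subset by blast
      show "norm (d x - d t0) \<le> norm T / 4" if "x \<in> ball t0 \<delta>" for x
        using \<delta>(2)[of x] that by (simp add: T_def dist_commute)
      show "t0 \<in> ball t0 \<delta>" using \<delta>(1) by simp
      show "(\<gamma> has_vector_derivative d x) (at x within ball t0 \<delta>)" for x
        using der has_vector_derivative_at_within by blast
    qed
    then have le: "norm (q' - q - (t' - t) *\<^sub>R T) \<le> \<bar>t' - t\<bar> * (norm T / 4)"
      using t by (simp add: T_def)
    have "norm ((q' - q) / T - of_real (t' - t)) = norm (q' - q - (t' - t) *\<^sub>R T) / norm T"
      using T by (simp add: norm_divide[symmetric] scaleR_conv_of_real diff_divide_distrib)
    also have "\<dots> \<le> \<bar>t' - t\<bar> * (norm T / 4) / norm T"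
      by (intro divide_right_mono le) simp
    also have "\<dots> = \<bar>t' - t\<bar> / 4" using T by simp
    finally have le': "norm ((q' - q) / T - of_real (t' - t)) \<le> \<bar>t' - t\<bar> / 4" .
    \<comment> \<open>In absolute value, the real part is at least 3/4 and the imaginary part at
      most 1/4 of the parameter difference.\<close>
    have real: "\<bar>y\<bar> \<le> \<bar>x\<bar> / 2" if "\<bar>y - 0\<bar> \<le> n" "\<bar>x - \<tau>\<bar> \<le> n" "n \<le> \<bar>\<tau>\<bar> / 4" for x y n \<tau> :: real
      using that by linarith
    show "\<bar>Im ((q' - q) / T)\<bar> \<le> \<bar>Re ((q' - q) / T)\<bar> / 2"
      using abs_Im_le_cmod[of "(q' - q) / T - of_real (t' - t)"]
        abs_Re_le_cmod[of "(q' - q) / T - of_real (t' - t)"] le'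
      unfolding minus_complex.sel Re_complex_of_real Im_complex_of_real by (rule real)
  next
    fix q z assume q: "q \<in> C" "q \<in> ball p R" and near_q: "\<And>y. y \<in> C \<Longrightarrow> dist z q \<le> dist z y"
    obtain t where t: "t \<in> ball t0 \<delta>" "\<gamma> t = q" using near q by metis
    \<comment> \<open>The squared distance from \<open>z\<close> to the curve is minimal at
      \<open>t\<close>, hence critical there, so \<open>z - q\<close> is orthogonal to the velocity.
      The minimum is over the whole curve, so any radius serves, here 1.\<close>
    have "((\<lambda>s. (\<gamma> s - z) \<bullet> (\<gamma> s - z)) has_real_derivative 2 * (d t \<bullet> (q - z))) (at t)"
      unfolding has_field_derivative_def
      by (rule has_derivative_eq_rhs, rule has_derivative_inner)
        (auto intro!: derivative_eq_intros der[unfolded has_vector_derivative_def] simp: t fun_eq_iff inner_commute)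
    then have "2 * (d t \<bullet> (q - z)) = 0"
    proof (rule DERIV_local_min[of _ _ _ 1])
      show "\<forall>y. \<bar>t - y\<bar> < 1 \<longrightarrow> (\<gamma> t - z) \<bullet> (\<gamma> t - z) \<le> (\<gamma> y - z) \<bullet> (\<gamma> y - z)"
        using near_q[OF C_image] t(2) by (simp add: dot_square_norm dist_norm norm_minus_commute)
    qed simp
    then have orth: "d t \<bullet> (z - q) = 0" by (simp add: inner_diff_right)
    \<comment> \<open>After division by \<open>T\<close> the velocity is \<open>1 + e\<close> with
      \<open>e\<close> small, so a vector orthogonal to it is nearly vertical.\<close>
    define e v where "e = (d t - T) / T" and "v = (z - q) / T"
    have "d t = T * (1 + e)" "z - q = T * v" using T by (auto simp: e_def v_def field_simps)
    then have "0 = (T * (1 + e)) \<bullet> (T * v)" using orth by simp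
    also have "\<dots> = (Re T ^ 2 + Im T ^ 2) * ((1 + Re e) * Re v + Im e * Im v)"
      by (simp add: inner_complex_def) algebra
    finally have eq: "(1 + Re e) * Re v + Im e * Im v = 0"
      using T unfolding complex_neq_0 by (metis less_irrefl mult_eq_0_iff)
    have "norm e < 1/4"
      using \<delta>(2)[of t] t(1) T by (simp add: e_def norm_divide divide_less_eq dist_commute)
    then have e: "\<bar>Re e\<bar> \<le> 1/4" "\<bar>Im e\<bar> \<le> 1/4"
      using abs_Re_le_cmod[of e] abs_Im_le_cmod[of e] by linarith+
    have "3/4 * \<bar>Re v\<bar> \<le> \<bar>1 + Re e\<bar> * \<bar>Re v\<bar>"
      using e(1) by (intro mult_right_mono) auto
    also have "\<dots> = \<bar>Im e\<bar> * \<bar>Im v\<bar>"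
      using eq unfolding abs_mult[symmetric] by linarith
    also have "\<dots> \<le> 1/4 * \<bar>Im v\<bar>" using e(2) by (intro mult_right_mono) auto
    finally show "\<bar>Re ((z - q) / T)\<bar> \<le> \<bar>Im ((z - q) / T)\<bar> / 2"
      unfolding v_def[symmetric] by linarith
  qed
qed


section \<open>Cones about the normal direction\<close>

text \<open>A right-angled cone about \<open>\<i> * T\<close>, the normal to a tangent
  \<open>T\<close>; \<open>- T\<close> gives the opposite cone. Its boundary slope 1 lies strictly
  between the slope bounds of \<open>smooth_curve_local\<close>, so chords of the curve avoid the
  cone, while normals fall into it or into its opposite.\<close>

definition open_cone :: "complex \<Rightarrow> complex set" where
  "open_cone T = {\<zeta>. \<bar>Re (\<zeta> / T)\<bar> < Im (\<zeta> / T)}"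

lemma open_cone_uminus: "\<zeta> \<in> open_cone (- T) \<longleftrightarrow> - \<zeta> \<in> open_cone T"
  by (simp add: open_cone_def)

lemma open_cone_scaleR:
  assumes "\<zeta> \<in> open_cone T" "u > 0"
  shows "u *\<^sub>R \<zeta> \<in> open_cone T"
proof -
  have "\<bar>u * Re (\<zeta> / T)\<bar> < u * Im (\<zeta> / T)"
    using assms by (simp add: open_cone_def abs_mult)
  moreover have "(u *\<^sub>R \<zeta>) / T = u *\<^sub>R (\<zeta> / T)"
    by (simp add: scaleR_conv_of_real)
  ultimately show ?thesis
    by (simp only: open_cone_def mem_Collect_eq scaleR_complex.sel)
qed

lemma convex_open_cone: "convex (open_cone T)"
  unfolding convex_def open_cone_def
proof (intro ballI allI impI, unfold mem_Collect_eq)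
  fix x y and u v :: real
  assume xy: "\<bar>Re (x / T)\<bar> < Im (x / T)" "\<bar>Re (y / T)\<bar> < Im (y / T)"
    and uv: "0 \<le> u" "0 \<le> v" "u + v = 1"
  have eq: "(u *\<^sub>R x + v *\<^sub>R y) / T = u *\<^sub>R (x / T) + v *\<^sub>R (y / T)"
    by (simp add: add_divide_distrib scaleR_conv_of_real)
  have "\<bar>u * Re (x / T) + v * Re (y / T)\<bar> \<le> u * \<bar>Re (x / T)\<bar> + v * \<bar>Re (y / T)\<bar>"
    using uv by (metis abs_mult abs_of_nonneg abs_triangle_ineq)
  also have "\<dots> < u * Im (x / T) + v * Im (y / T)"
  proof (cases "u = 0")
    case True
    then show ?thesis using uv xy by simp
  next
    case False
    then show ?thesis using uv xy
      by (intro add_less_le_mono mult_strict_left_mono mult_left_mono) auto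
  qed
  finally show "\<bar>Re ((u *\<^sub>R x + v *\<^sub>R y) / T)\<bar> < Im ((u *\<^sub>R x + v *\<^sub>R y) / T)"
    unfolding eq by simp
qed

definition cone_sector :: "complex \<Rightarrow> real \<Rightarrow> complex \<Rightarrow> complex set" where
  "cone_sector T \<rho> q = (+) q ` (open_cone T \<inter> ball 0 \<rho>)"

lemma mem_cone_sector: "z \<in> cone_sector T \<rho> q \<longleftrightarrow> z - q \<in> open_cone T \<and> norm (z - q) < \<rho>"
  unfolding cone_sector_def by (auto simp: image_iff intro!: bexI[of _ "z - q"])

lemma connected_cone_sector: "connected (cone_sector T \<rho> q)"
  unfolding cone_sector_def
  by (intro convex_connected convex_translation convex_Int convex_open_cone convex_ball)

lemma cone_sector_meet:
  assumes "T \<noteq> 0" "\<rho> > 0" "dist p q < \<rho> / 4"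
  shows "cone_sector T \<rho> p \<inter> cone_sector T \<rho> q \<noteq> {}"
proof -
  \<comment> \<open>The common point is \<open>p\<close> moved along the axis by
    \<open>\<rho> / 2\<close>. Passing from \<open>p\<close> to \<open>q\<close> shifts its relative
    position by less than \<open>s / 2\<close> in units of \<open>T\<close>, too little to leave the
    cone.\<close>
  define s where "s = \<rho> / (2 * norm T)"
  have s: "s > 0" "s * norm T = \<rho> / 2" using assms by (auto simp: s_def)
  define x where "x = p + of_real s * (\<i> * T)"
  have n: "norm (of_real s * (\<i> * T)) = \<rho> / 2" using s by (simp add: norm_mult)
  have "x \<in> cone_sector T \<rho> p"
    unfolding mem_cone_sector x_def using n assms s by (simp add: open_cone_def)
  moreover have "x \<in> cone_sector T \<rho> q"
    unfolding mem_cone_sector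
  proof
    have "(x - q) / T = (p - q) / T + of_real s * \<i>"
      using assms by (simp add: x_def field_simps)
    moreover have "norm ((p - q) / T) < s / 2"
      using assms by (simp add: norm_divide s_def dist_norm field_simps)
    ultimately show "x - q \<in> open_cone T"
      using abs_Re_le_cmod[of "(p - q) / T"] abs_Im_le_cmod[of "(p - q) / T"]
      by (simp add: open_cone_def del: complex_Re_le_cmod)
    have "norm (x - q) \<le> norm (p - q) + norm (of_real s * (\<i> * T))"
      unfolding x_def by (metis add_diff_eq add.commute diff_add_eq norm_triangle_ineq)
    then show "norm (x - q) < \<rho>" using n assms by (simp add: dist_norm)
  qed
  ultimately show ?thesis by blast
qed

section \<open>The two sides of the boundary\<close>

text \<open>The other curves are finitely many closed sets missing \<open>p\<close>, so some ball
  around \<open>p\<close> misses them all.\<close>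

lemma smooth_bounded_domain_curve_at:
  assumes "smooth_bounded_domain \<Omega>" "p \<in> frontier \<Omega>"
  obtains C R where "smooth_simple_closed_curve C" "p \<in> C" "C \<subseteq> frontier \<Omega>" "R > 0"
    "frontier \<Omega> \<inter> ball p R \<subseteq> C"
proof -
  obtain \<C> where \<C>: "finite \<C>" "pairwise disjnt \<C>" "\<forall>C\<in>\<C>. smooth_simple_closed_curve C"
    "frontier \<Omega> = \<Union>\<C>"
    using assms(1) unfolding smooth_bounded_domain_def by blast
  obtain C where C: "C \<in> \<C>" "p \<in> C" using assms(2) \<C>(4) by blast
  have "closed (\<Union>(\<C> - {C}))"
    using \<C>(1,3) unfolding smooth_simple_closed_curve_def
    by (intro closed_Union) (auto intro: closed_simple_path_image)
  moreover have "p \<notin> \<Union>(\<C> - {C})"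
    using C \<C>(2) by (auto simp: pairwise_def disjnt_def)
  ultimately obtain R where "R > 0" "ball p R \<inter> \<Union>(\<C> - {C}) = {}"
    by (metis ComplI open_Compl open_contains_ball_eq disjoint_eq_subset_Compl)
  then show thesis using that[of C R] C \<C> by blast
qed

text \<open>By the Jordan curve theorem the curve is the full frontier of its inside and also of its
  outside. A connected \<open>S\<close> lies in one of the two, and \<open>D\<close> is the
  other.\<close>

lemma smooth_simple_closed_curve_complement:
  assumes "smooth_simple_closed_curve C" "connected S" "S \<inter> C = {}"
  obtains D where "D \<inter> S = {}" "D \<inter> C = {}" "C = frontier D"
proof -
  obtain \<gamma> :: "real \<Rightarrow> complex" where per: "\<And>t. \<gamma> (t + 1) = \<gamma> t"
    and sp: "simple_path \<gamma>" "path_image \<gamma> = C"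
    using assms(1) unfolding smooth_simple_closed_curve_def by blast
  have "pathfinish \<gamma> = pathstart \<gamma>" using per[of 0] by (simp add: pathfinish_def pathstart_def)
  note J = Jordan_inside_outside[OF sp(1) this, unfolded sp(2)]
  have "S \<subseteq> inside C \<union> outside C" using J assms(3) by blast
  then have "inside C \<inter> S = {} \<or> outside C \<inter> S = {}"
    using connectedD[OF assms(2), of "inside C" "outside C"] J by blast
  then show thesis
  proof
    assume "inside C \<inter> S = {}"
    then show thesis by (rule that) (use J in simp_all)
  next
    assume "outside C \<inter> S = {}"
    then show thesis by (rule that) (use J in simp_all)
  qed
qed

text \<open>Near \<open>p\<close>, the sectors at points of the curve avoid the frontier, so each
  lies inside or off \<Omega>, and by overlap all sectors of one direction agree with the one at
  \<open>p\<close>. Exactly one of the two directions points into \<Omega>. A segment from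
  \<open>z\<close> in that direction cannot leave \<Omega>, since at an exit point the opposite
  sector would contain \<open>z\<close>. One \<open>T\<close> serves all \<open>z\<close> near
  \<open>p\<close>, which later lets the cones at two points meet.\<close>

lemma smooth_bounded_domain_cone_condition:
  assumes \<Omega>: "smooth_bounded_domain \<Omega>" and p: "p \<in> frontier \<Omega>"
  obtains T r where "T \<noteq> 0" "r > 0"
    "\<And>z. z \<in> \<Omega> \<Longrightarrow> z \<in> ball p r \<Longrightarrow> cone_sector T r z \<subseteq> \<Omega>"
proof -
  have op: "open \<Omega>" "connected \<Omega>" using \<Omega> by (auto simp: smooth_bounded_domain_def planar_domain_def)
  have disj: "\<Omega> \<inter> frontier \<Omega> = {}" using op by (simp add: frontier_def interior_open)
  obtain C R1 where C: "smooth_simple_closed_curve C" "p \<in> C" "C \<subseteq> frontier \<Omega>" "R1 > 0"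
    "frontier \<Omega> \<inter> ball p R1 \<subseteq> C"
    using smooth_bounded_domain_curve_at[OF \<Omega> p] by blast
  have clC: "closed C"
    using C(1) unfolding smooth_simple_closed_curve_def by (auto intro: closed_simple_path_image)
  obtain T R2 where T: "T \<noteq> 0" "R2 > 0"
    "\<And>q q'. \<lbrakk>q \<in> C; q' \<in> C; q \<in> ball p R2; q' \<in> ball p R2\<rbrakk>
        \<Longrightarrow> \<bar>Im ((q' - q) / T)\<bar> \<le> \<bar>Re ((q' - q) / T)\<bar> / 2"
    "\<And>q z. \<lbrakk>q \<in> C; q \<in> ball p R2; \<And>y. y \<in> C \<Longrightarrow> dist z q \<le> dist z y\<rbrakk>
        \<Longrightarrow> \<bar>Re ((z - q) / T)\<bar> \<le> \<bar>Im ((z - q) / T)\<bar> / 2"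
    using smooth_curve_local[OF C(1,2)] by blast
  define R where "R = min R1 R2"
  have R: "R > 0" "R \<le> R1" "R \<le> R2" using C(4) T(2) by (auto simp: R_def)
  define \<rho> where "\<rho> = R / 2"
  have \<rho>: "\<rho> > 0" using R by (simp add: \<rho>_def)
  \<comment> \<open>Near \<open>p\<close>, chords have slope at most 1/2 relative to
    \<open>T\<close>, sector points slope above 1. Since \<rho> is half of \<open>R\<close>, the
    sector stays inside the ball where both bounds hold.\<close>
  have sector_frontier: "cone_sector \<tau> \<rho> q \<inter> frontier \<Omega> = {}"
    if "q \<in> C" "dist p q < \<rho>" "\<tau> = T \<or> \<tau> = - T" for q \<tau>
  proof (rule ccontr)
    assume "cone_sector \<tau> \<rho> q \<inter> frontier \<Omega> \<noteq> {}"
    then obtain x where x: "x \<in> cone_sector \<tau> \<rho> q" "x \<in> frontier \<Omega>" by blast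
    have "dist p x \<le> dist p q + dist q x" by (rule dist_triangle)
    then have px: "dist p x < R" using x(1) that(2)
      by (simp add: mem_cone_sector \<rho>_def dist_norm norm_minus_commute)
    then have "x \<in> C" using C(5) x(2) R(2) by auto
    then have "\<bar>Im ((x - q) / T)\<bar> \<le> \<bar>Re ((x - q) / T)\<bar> / 2"
      using T(3)[OF that(1)] that(2) px R(3) \<rho> by (auto simp: \<rho>_def)
    moreover have "\<bar>Re ((x - q) / T)\<bar> < \<bar>Im ((x - q) / T)\<bar>"
      using x(1) that(3) by (auto simp: mem_cone_sector open_cone_def)
    ultimately show False by linarith
  qed
  have sector_cases: "cone_sector \<tau> \<rho> q \<subseteq> \<Omega> \<or> cone_sector \<tau> \<rho> q \<inter> \<Omega> = {}"
    if "q \<in> C" "dist p q < \<rho>" "\<tau> = T \<or> \<tau> = - T" for q \<tau>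
    using connected_Int_frontier[OF connected_cone_sector[of \<tau> \<rho> q], of \<Omega>] sector_frontier[OF that]
    by blast
  have sector_const: "(cone_sector \<tau> \<rho> p \<subseteq> \<Omega> \<and> cone_sector \<tau> \<rho> q \<subseteq> \<Omega>) \<or>
      (\<not> cone_sector \<tau> \<rho> p \<subseteq> \<Omega> \<and> cone_sector \<tau> \<rho> q \<inter> \<Omega> = {})"
    if "q \<in> C" "dist p q < \<rho> / 4" "\<tau> = T \<or> \<tau> = - T" for q \<tau>
  proof -
    have "cone_sector \<tau> \<rho> p \<inter> cone_sector \<tau> \<rho> q \<noteq> {}"
      using that T(1) \<rho> by (intro cone_sector_meet) auto
    then show ?thesis
      using sector_cases[of q \<tau>] sector_cases[of p \<tau>] that C(2) \<rho> by auto
  qed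
  \<comment> \<open>Join \<open>z\<close> to its nearest point on the curve; that segment is normal to the curve.\<close>
  have covered: "\<exists>q\<in>C. dist p q < \<rho> / 4 \<and> (z \<in> cone_sector T \<rho> q \<or> z \<in> cone_sector (- T) \<rho> q)"
    if "dist p z < \<rho> / 8" "z \<notin> C" for z
  proof -
    obtain q where q: "q \<in> C" "\<And>y. y \<in> C \<Longrightarrow> dist z q \<le> dist z y"
      using distance_attains_inf[OF clC] C(2) by blast
    have zq: "dist z q < \<rho> / 8" using q(2)[OF C(2)] that(1) by (simp add: dist_commute)
    then have pq: "dist p q < \<rho> / 4" using that(1) dist_triangle[of p q z] by simp
    then have le: "\<bar>Re ((z - q) / T)\<bar> \<le> \<bar>Im ((z - q) / T)\<bar> / 2"
      using q T(4)[of q z] R \<rho> by (auto simp: \<rho>_def)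
    have "(z - q) / T \<noteq> 0" using that(2) q(1) T(1) by auto
    then have "Im ((z - q) / T) \<noteq> 0" using le by (auto simp: complex_eq_iff)
    then have "z - q \<in> open_cone T \<or> z - q \<in> open_cone (- T)"
      using le unfolding open_cone_def by auto
    then show ?thesis using q(1) pq zq \<rho> by (auto simp: mem_cone_sector dist_norm)
  qed
  \<comment> \<open>Otherwise \<open>\<Omega>\<close> would fill a punctured neighbourhood of \<open>p\<close> off the curve, leaving no room for
    the component of the complement of \<open>C\<close> that does not contain \<open>\<Omega>\<close>.\<close>
  have one_side: "\<not> (cone_sector T \<rho> p \<subseteq> \<Omega> \<and> cone_sector (- T) \<rho> p \<subseteq> \<Omega>)"
  proof
    assume both: "cone_sector T \<rho> p \<subseteq> \<Omega> \<and> cone_sector (- T) \<rho> p \<subseteq> \<Omega>"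
    obtain D where D: "D \<inter> \<Omega> = {}" "D \<inter> C = {}" "C = frontier D"
      using smooth_simple_closed_curve_complement[OF C(1) op(2)] disj C(3) by blast
    have "p \<in> closure D" using C(2) D(3) by (simp add: frontier_def)
    then obtain z where z: "z \<in> D" "dist z p < \<rho> / 8"
      using \<rho> unfolding closure_approachable by (meson divide_pos_pos zero_less_numeral)
    then obtain q where "q \<in> C" "dist p q < \<rho> / 4" "z \<in> cone_sector T \<rho> q \<or> z \<in> cone_sector (- T) \<rho> q"
      using covered[of z] D by (auto simp: dist_commute)
    then have "z \<in> \<Omega>" using both sector_const[of q T] sector_const[of q "- T"] by blast
    then show False using z D by blast
  qed
  have some_side: "cone_sector T \<rho> p \<subseteq> \<Omega> \<or> cone_sector (- T) \<rho> p \<subseteq> \<Omega>"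
  proof -
    have "p \<in> closure \<Omega>" using p by (simp add: frontier_def)
    then obtain z where z: "z \<in> \<Omega>" "dist z p < \<rho> / 8"
      using \<rho> unfolding closure_approachable by (meson divide_pos_pos zero_less_numeral)
    then obtain q where "q \<in> C" "dist p q < \<rho> / 4" "z \<in> cone_sector T \<rho> q \<or> z \<in> cone_sector (- T) \<rho> q"
      using covered[of z] disj C(3) by (auto simp: dist_commute)
    then show ?thesis using z(1) sector_const[of q T] sector_const[of q "- T"] by blast
  qed
  obtain \<tau> where \<tau>: "\<tau> = T \<or> \<tau> = - T" "cone_sector \<tau> \<rho> p \<subseteq> \<Omega>" "\<not> cone_sector (- \<tau>) \<rho> p \<subseteq> \<Omega>"
    using one_side some_side by (metis minus_minus)
  show thesis
  proof (rule that[of \<tau> "\<rho> / 8"])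
    show "\<tau> \<noteq> 0" "\<rho> / 8 > 0" using \<tau>(1) T(1) \<rho> by auto
    fix z assume z: "z \<in> \<Omega>" "z \<in> ball p (\<rho> / 8)"
    show "cone_sector \<tau> (\<rho> / 8) z \<subseteq> \<Omega>"
    proof
      fix y assume y: "y \<in> cone_sector \<tau> (\<rho> / 8) z"
      show "y \<in> \<Omega>"
      proof (rule ccontr)
        assume "y \<notin> \<Omega>"
        then obtain q where q: "q \<in> closed_segment z y" "q \<in> frontier \<Omega>"
          using connected_Int_frontier[of "closed_segment z y" \<Omega>] z(1) by auto
        obtain u where u: "0 \<le> u" "u \<le> 1" "q = (1 - u) *\<^sub>R z + u *\<^sub>R y"
          using q(1) unfolding closed_segment_def by blast
        have qz: "q - z = of_real u * (y - z)"
          by (simp add: u(3) scaleR_conv_of_real algebra_simps)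
        have "u \<noteq> 0" using u(3) z(1) q(2) disj by auto
        then have "u > 0" using u(1) by simp
        have "norm (q - z) = u * norm (y - z)" using u(1) by (simp add: qz norm_mult)
        also have "\<dots> \<le> norm (y - z)" using u by (simp add: mult_left_le_one_le)
        also have "\<dots> < \<rho> / 8" using y by (simp add: mem_cone_sector)
        finally have nqz: "norm (q - z) < \<rho> / 8" .
        then have pq: "dist p q < \<rho> / 4"
          using z(2) dist_triangle[of p q z] by (simp add: dist_norm norm_minus_commute)
        then have "q \<in> C" using C(5) q(2) R \<rho> by (auto simp: \<rho>_def)
        have "q - z \<in> open_cone \<tau>"
          using open_cone_scaleR[OF _ \<open>u > 0\<close>] y
          by (simp add: qz mem_cone_sector flip: scaleR_conv_of_real)
        \<comment> \<open>seen from the boundary point \<open>q\<close>, the point \<open>z\<close> lies on the side away from \<open>\<Omega>\<close>\<close>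
        then have "z - q \<in> open_cone (- \<tau>)" by (simp add: open_cone_uminus)
        then have "z \<in> cone_sector (- \<tau>) \<rho> q"
          using nqz \<rho> by (simp add: mem_cone_sector norm_minus_commute)
        moreover have "cone_sector (- \<tau>) \<rho> q \<inter> \<Omega> = {}"
          using sector_const[OF \<open>q \<in> C\<close> pq, of "- \<tau>"] \<tau> by auto
        ultimately show False using z(1) by blast
      qed
    qed
  qed
qed

section \<open>Lipschitz bounds\<close>

lemma holomorphic_segment_bound:
  assumes "open \<Omega>" "u holomorphic_on \<Omega>" "\<And>x. x \<in> \<Omega> \<Longrightarrow> norm (deriv u x) \<le> \<epsilon>"
    "closed_segment z w \<subseteq> \<Omega>"
  shows "norm (u z - u w) \<le> \<epsilon> * norm (z - w)"
  using assms
  by (intro field_differentiable_bound[of "closed_segment z w" u "deriv u"])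
    (auto intro: holomorphic_derivI)

lemma closed_segment_cone_sector:
  assumes "y \<in> cone_sector T \<rho> z"
  shows "closed_segment z y \<subseteq> insert z (cone_sector T \<rho> z)"
proof
  fix x assume "x \<in> closed_segment z y"
  then obtain u where u: "0 \<le> u" "u \<le> 1" "x = (1 - u) *\<^sub>R z + u *\<^sub>R y"
    unfolding closed_segment_def by blast
  have xz: "x - z = u *\<^sub>R (y - z)" by (simp add: u(3) algebra_simps)
  show "x \<in> insert z (cone_sector T \<rho> z)"
  proof (cases "u = 0")
    case True
    then show ?thesis using u(3) by simp
  next
    case False
    have "norm (x - z) \<le> norm (y - z)"
      using u(1,2) by (simp add: xz mult_left_le_one_le)
    then show ?thesis
      using assms open_cone_scaleR[of "y - z" T u] False u(1) by (simp add: mem_cone_sector xz)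
  qed
qed

text \<open>The radius is chosen before \<open>u\<close> and \<epsilon>. Near the boundary the
  segment from \<open>z\<close> to \<open>w\<close> may leave \<Omega>; a detour through a point of
  both cones has legs of at most 3 and 4 times the distance, whence the 7.\<close>

lemma smooth_bounded_domain_local_Lipschitz:
  assumes \<Omega>: "smooth_bounded_domain \<Omega>" and p: "p \<in> closure \<Omega>"
  shows "\<exists>r>0. \<forall>u \<epsilon>. u holomorphic_on \<Omega> \<longrightarrow> (\<forall>x\<in>\<Omega>. norm (deriv u x) \<le> \<epsilon>) \<longrightarrow>
    (\<forall>z\<in>\<Omega> \<inter> ball p r. \<forall>w\<in>\<Omega> \<inter> ball p r. norm (u z - u w) \<le> 7 * \<epsilon> * norm (z - w))"
proof -
  have op: "open \<Omega>" using \<Omega> by (simp add: smooth_bounded_domain_def planar_domain_def)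
  show ?thesis
  proof (cases "p \<in> \<Omega>")
    case True
    then obtain r where r: "r > 0" "ball p r \<subseteq> \<Omega>" using op open_contains_ball by blast
    show ?thesis
    proof (intro exI[of _ r] conjI allI impI ballI r(1))
      fix u :: "complex \<Rightarrow> complex" and \<epsilon> z w
      assume u: "u holomorphic_on \<Omega>" "\<forall>x\<in>\<Omega>. norm (deriv u x) \<le> \<epsilon>"
        and zw: "z \<in> \<Omega> \<inter> ball p r" "w \<in> \<Omega> \<inter> ball p r"
      have "0 \<le> \<epsilon>" using u(2) True norm_ge_zero order_trans by blast
      have "closed_segment z w \<subseteq> \<Omega>"
        using zw r(2) convex_ball closed_segment_subset by blast
      then have "norm (u z - u w) \<le> \<epsilon> * norm (z - w)"
        using holomorphic_segment_bound op u by blast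
      also have "\<dots> \<le> 7 * \<epsilon> * norm (z - w)"
        using \<open>0 \<le> \<epsilon>\<close> by (intro mult_right_mono) auto
      finally show "norm (u z - u w) \<le> 7 * \<epsilon> * norm (z - w)" .
    qed
  next
    case False
    then have "p \<in> frontier \<Omega>" using p op by (simp add: frontier_def interior_open)
    then obtain T r where T: "T \<noteq> 0" "r > 0"
      and cone: "\<And>z. z \<in> \<Omega> \<Longrightarrow> z \<in> ball p r \<Longrightarrow> cone_sector T r z \<subseteq> \<Omega>"
      using smooth_bounded_domain_cone_condition[OF \<Omega>] by blast
    show ?thesis
    \<comment> \<open>Points this close have distance \<open>d < r / 4\<close>, so legs of length up
      to \<open>4 * d\<close> stay within sectors of radius \<open>r\<close>.\<close>
    proof (intro exI[of _ "r / 8"] conjI allI impI ballI)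
      show "r / 8 > 0" using T by simp
      fix u :: "complex \<Rightarrow> complex" and \<epsilon> z w
      assume u: "u holomorphic_on \<Omega>" "\<forall>x\<in>\<Omega>. norm (deriv u x) \<le> \<epsilon>"
        and zw: "z \<in> \<Omega> \<inter> ball p (r / 8)" "w \<in> \<Omega> \<inter> ball p (r / 8)"
      have "0 \<le> \<epsilon>" using u(2) zw norm_ge_zero order_trans by blast
      show "norm (u z - u w) \<le> 7 * \<epsilon> * norm (z - w)"
      proof (cases "z = w")
        case False
        define d where "d = norm (z - w)"
        have d: "d > 0" using False by (simp add: d_def)
        have dr: "d < r / 4"
          using zw dist_triangle[of z w p] by (simp add: d_def dist_norm norm_minus_commute)
        define s where "s = d / norm T"
        have s: "s > 0" using d T by (simp add: s_def)
        \<comment> \<open>a point so high above \<open>z\<close> that it lies in the cones at both \<open>z\<close> and \<open>w\<close>\<close>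
        define y where "y = z + of_real (3 * s) * (\<i> * T)"
        have yz: "norm (y - z) = 3 * d"
        proof -
          have "norm (y - z) = 3 * (s * norm T)"
            using s by (simp add: y_def norm_mult)
          then show ?thesis using T by (simp add: s_def)
        qed
        have yw: "norm (y - w) \<le> 4 * d"
          using norm_triangle_ineq[of "y - z" "z - w"] yz by (simp add: d_def)
        have y1: "y \<in> cone_sector T r z"
          unfolding mem_cone_sector yz using T s dr d by (simp add: y_def open_cone_def)
        have y2: "y \<in> cone_sector T r w"
          unfolding mem_cone_sector
        proof
          have "(y - w) / T = (z - w) / T + of_real (3 * s) * \<i>"
            using T by (simp add: y_def field_simps)
          moreover have "norm ((z - w) / T) = s"
            by (simp add: norm_divide s_def d_def)
          ultimately show "y - w \<in> open_cone T"
            using abs_Re_le_cmod[of "(z - w) / T"] abs_Im_le_cmod[of "(z - w) / T"] s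
            by (simp add: open_cone_def)
          show "norm (y - w) < r" using yw dr by simp
        qed
        have "closed_segment z y \<subseteq> \<Omega>"
          using closed_segment_cone_sector[OF y1] cone[of z] zw T by auto
        then have "norm (u z - u y) \<le> \<epsilon> * norm (z - y)"
          using holomorphic_segment_bound op u by blast
        moreover have "closed_segment w y \<subseteq> \<Omega>"
          using closed_segment_cone_sector[OF y2] cone[of w] zw T by auto
        then have "norm (u w - u y) \<le> \<epsilon> * norm (w - y)"
          using holomorphic_segment_bound op u by blast
        moreover have "\<epsilon> * norm (w - y) \<le> \<epsilon> * (4 * d)"
          using yw \<open>0 \<le> \<epsilon>\<close> by (intro mult_left_mono) (auto simp: norm_minus_commute)
        ultimately have "norm (u z - u y) + norm (u w - u y) \<le> 7 * \<epsilon> * d"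
          using yz by (simp add: norm_minus_commute)
        then show ?thesis
          using norm_triangle_ineq4[of "u z - u y" "u w - u y"] by (simp add: d_def)
      qed simp
    qed
  qed
qed

section \<open>From local to global Lipschitz bounds\<close>

text \<open>The point is that \<open>B\<close> depends on the two points and \<open>\<Omega>\<close> only.\<close>

lemma holomorphic_bounded_oscillation:
  assumes "open \<Omega>" "connected \<Omega>" "a \<in> \<Omega>" "b \<in> \<Omega>"
  shows "\<exists>B. \<forall>u \<epsilon>. u holomorphic_on \<Omega> \<longrightarrow> (\<forall>x\<in>\<Omega>. norm (deriv u x) \<le> \<epsilon>) \<longrightarrow>
    norm (u a - u b) \<le> B * \<epsilon>"
\<comment> \<open>The existence of \<open>B\<close> is symmetric and transitive in the two points
  and holds from the centre to any point of a ball inside \<Omega>; connectedness spreads it to all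
  pairs.\<close>
proof (rule connected_equivalence_relation[OF assms(2-4)])
  fix x y
  assume "\<exists>B. \<forall>u \<epsilon>. u holomorphic_on \<Omega> \<longrightarrow> (\<forall>x\<in>\<Omega>. norm (deriv u x) \<le> \<epsilon>) \<longrightarrow>
    norm (u x - u y) \<le> B * \<epsilon>"
  then show "\<exists>B. \<forall>u \<epsilon>. u holomorphic_on \<Omega> \<longrightarrow> (\<forall>x\<in>\<Omega>. norm (deriv u x) \<le> \<epsilon>) \<longrightarrow>
    norm (u y - u x) \<le> B * \<epsilon>"
    by (simp add: norm_minus_commute)
next
  fix x y z
  assume "\<exists>B. \<forall>u \<epsilon>. u holomorphic_on \<Omega> \<longrightarrow> (\<forall>x\<in>\<Omega>. norm (deriv u x) \<le> \<epsilon>) \<longrightarrow>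
      norm (u x - u y) \<le> B * \<epsilon>"
    and "\<exists>B. \<forall>u \<epsilon>. u holomorphic_on \<Omega> \<longrightarrow> (\<forall>x\<in>\<Omega>. norm (deriv u x) \<le> \<epsilon>) \<longrightarrow>
      norm (u y - u z) \<le> B * \<epsilon>"
  then obtain B1 B2 where
    B: "\<And>u \<epsilon>. u holomorphic_on \<Omega> \<Longrightarrow> (\<forall>x\<in>\<Omega>. norm (deriv u x) \<le> \<epsilon>) \<Longrightarrow> norm (u x - u y) \<le> B1 * \<epsilon>"
    "\<And>u \<epsilon>. u holomorphic_on \<Omega> \<Longrightarrow> (\<forall>x\<in>\<Omega>. norm (deriv u x) \<le> \<epsilon>) \<Longrightarrow> norm (u y - u z) \<le> B2 * \<epsilon>"
    by blast
  show "\<exists>B. \<forall>u \<epsilon>. u holomorphic_on \<Omega> \<longrightarrow> (\<forall>x\<in>\<Omega>. norm (deriv u x) \<le> \<epsilon>) \<longrightarrow>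
    norm (u x - u z) \<le> B * \<epsilon>"
  proof (intro exI[of _ "B1 + B2"] allI impI)
    fix u :: "complex \<Rightarrow> complex" and \<epsilon>
    assume u: "u holomorphic_on \<Omega>" "\<forall>x\<in>\<Omega>. norm (deriv u x) \<le> \<epsilon>"
    have "norm (u x - u z) \<le> norm (u x - u y) + norm (u y - u z)"
      using norm_triangle_ineq[of "u x - u y" "u y - u z"] by simp
    then show "norm (u x - u z) \<le> (B1 + B2) * \<epsilon>"
      using B[OF u] by (simp add: distrib_right)
  qed
next
  fix x assume "x \<in> \<Omega>"
  then obtain r where r: "r > 0" "ball x r \<subseteq> \<Omega>" using assms(1) open_contains_ball by blast
  show "\<exists>T. openin (top_of_set \<Omega>) T \<and> x \<in> T \<and> (\<forall>y\<in>T. \<exists>B. \<forall>u \<epsilon>. u holomorphic_on \<Omega> \<longrightarrow>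
      (\<forall>x\<in>\<Omega>. norm (deriv u x) \<le> \<epsilon>) \<longrightarrow> norm (u x - u y) \<le> B * \<epsilon>)"
  proof (intro exI[of _ "ball x r"] conjI ballI)
    show "openin (top_of_set \<Omega>) (ball x r)" using r by (simp add: open_subset)
    show "x \<in> ball x r" using r by simp
    fix y assume y: "y \<in> ball x r"
    have "closed_segment x y \<subseteq> \<Omega>"
      using closed_segment_subset[of x "ball x r" y] y r by auto
    then have "norm (u x - u y) \<le> norm (x - y) * \<epsilon>"
      if "u holomorphic_on \<Omega>" "\<forall>x\<in>\<Omega>. norm (deriv u x) \<le> \<epsilon>" for u \<epsilon>
      using holomorphic_segment_bound[of \<Omega> u \<epsilon> x y] that assms(1) by (simp add: mult.commute)
    then show "\<exists>B. \<forall>u \<epsilon>. u holomorphic_on \<Omega> \<longrightarrow>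
      (\<forall>x\<in>\<Omega>. norm (deriv u x) \<le> \<epsilon>) \<longrightarrow> norm (u x - u y) \<le> B * \<epsilon>" by blast
  qed
qed

text \<open>Finitely many local balls cover the closure. Points closer than a Lebesgue number
  \<delta> of the cover share a ball and have the constant 7. For points farther apart, the total
  oscillation \<open>2 * M * \<epsilon>\<close> is divided by \<delta>.\<close>

lemma smooth_bounded_domain_Lipschitz:
  assumes \<Omega>: "smooth_bounded_domain \<Omega>"
  obtains L where "L \<ge> 0" "\<And>u \<epsilon> z w. \<lbrakk>u holomorphic_on \<Omega>; \<And>x. x \<in> \<Omega> \<Longrightarrow> norm (deriv u x) \<le> \<epsilon>; z \<in> \<Omega>; w \<in> \<Omega>\<rbrakk>
    \<Longrightarrow> norm (u z - u w) \<le> L * \<epsilon> * norm (z - w)"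
proof -
  define adm where "adm = (\<lambda>u \<epsilon>. u holomorphic_on \<Omega> \<and> (\<forall>x\<in>\<Omega>. norm (deriv u x) \<le> \<epsilon>))"
  have op: "open \<Omega>" "connected \<Omega>" "\<Omega> \<noteq> {}" "bounded \<Omega>"
    using \<Omega> by (auto simp: smooth_bounded_domain_def planar_domain_def)
  have comp: "compact (closure \<Omega>)" using op(4) by (simp add: compact_closure)
  obtain a where a: "a \<in> \<Omega>" using op by blast
  have pos: "\<epsilon> \<ge> 0" if "adm u \<epsilon>" for u \<epsilon>
    using that a norm_ge_zero order_trans unfolding adm_def by blast
  have "\<forall>p\<in>closure \<Omega>. \<exists>r>0. \<forall>u \<epsilon>. adm u \<epsilon> \<longrightarrow>
    (\<forall>z\<in>\<Omega> \<inter> ball p r. \<forall>w\<in>\<Omega> \<inter> ball p r. norm (u z - u w) \<le> 7 * \<epsilon> * norm (z - w))"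
    unfolding adm_def imp_conjL by (intro ballI smooth_bounded_domain_local_Lipschitz[OF \<Omega>])
  then obtain r where r: "\<And>p. p \<in> closure \<Omega> \<Longrightarrow> r p > 0"
    "\<And>p u \<epsilon> z w. \<lbrakk>p \<in> closure \<Omega>; adm u \<epsilon>; z \<in> \<Omega> \<inter> ball p (r p); w \<in> \<Omega> \<inter> ball p (r p)\<rbrakk>
      \<Longrightarrow> norm (u z - u w) \<le> 7 * \<epsilon> * norm (z - w)"
    unfolding bchoice_iff by blast
  obtain P where P: "finite P" "P \<subseteq> closure \<Omega>" "closure \<Omega> \<subseteq> (\<Union>p\<in>P. ball p (r p))"
  proof (rule compactE_image[OF comp, of "closure \<Omega>" "\<lambda>p. ball p (r p)"])
    show "closure \<Omega> \<subseteq> (\<Union>p\<in>closure \<Omega>. ball p (r p))" using r(1) by force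
  qed auto
  have "\<exists>B\<ge>0. \<forall>u \<epsilon>. adm u \<epsilon> \<longrightarrow> (\<forall>z\<in>\<Omega> \<inter> ball p (r p). norm (u z - u a) \<le> B * \<epsilon>)"
    if p: "p \<in> P" for p
  proof -
    have pc: "p \<in> closure \<Omega>" using p P by blast
    then obtain b where b: "b \<in> \<Omega>" "dist b p < r p"
      using r(1)[OF pc] unfolding closure_approachable by blast
    obtain B where B: "\<And>u \<epsilon>. adm u \<epsilon> \<Longrightarrow> norm (u b - u a) \<le> B * \<epsilon>"
      using holomorphic_bounded_oscillation[OF op(1,2) b(1) a] unfolding adm_def by blast
    show ?thesis
    \<comment> \<open>Seven times the diameter of the ball accounts for the way from
      \<open>z\<close> to \<open>b\<close>, and \<open>B\<close> for that from \<open>b\<close> to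
      \<open>a\<close>; the sign of \<open>B\<close> is unknown, hence the absolute value.\<close>
    proof (intro exI[of _ "14 * r p + \<bar>B\<bar>"] conjI allI impI ballI)
      show "14 * r p + \<bar>B\<bar> \<ge> 0" using r(1)[OF pc] by simp
      fix u \<epsilon> z assume u: "adm u \<epsilon>" and z: "z \<in> \<Omega> \<inter> ball p (r p)"
      have zb: "norm (z - b) \<le> 2 * r p"
        using z b(2) dist_triangle[of z b p] by (simp add: dist_norm norm_minus_commute)
      have "norm (u z - u b) \<le> 7 * \<epsilon> * norm (z - b)"
        using r(2)[OF pc u z] b by (simp add: dist_commute)
      also have "\<dots> \<le> 7 * \<epsilon> * (2 * r p)"
        using zb pos[OF u] by (intro mult_left_mono) auto
      finally have "norm (u z - u b) \<le> 14 * r p * \<epsilon>" by (simp add: mult_ac)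
      moreover have "norm (u b - u a) \<le> \<bar>B\<bar> * \<epsilon>"
        using B[OF u] mult_right_mono[OF abs_ge_self[of B] pos[OF u]] by linarith
      ultimately show "norm (u z - u a) \<le> (14 * r p + \<bar>B\<bar>) * \<epsilon>"
        using norm_triangle_ineq[of "u z - u b" "u b - u a"] by (simp add: distrib_right)
    qed
  qed
  then have "\<forall>p\<in>P. \<exists>B. B \<ge> 0 \<and> (\<forall>u \<epsilon>. adm u \<epsilon> \<longrightarrow> (\<forall>z\<in>\<Omega> \<inter> ball p (r p). norm (u z - u a) \<le> B * \<epsilon>))"
    by blast
  then obtain B where B: "\<And>p. p \<in> P \<Longrightarrow> B p \<ge> 0"
    "\<And>p u \<epsilon> z. \<lbrakk>p \<in> P; adm u \<epsilon>; z \<in> \<Omega> \<inter> ball p (r p)\<rbrakk> \<Longrightarrow> norm (u z - u a) \<le> B p * \<epsilon>"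
    unfolding bchoice_iff by blast
  define M where "M = sum B P"
  have M0: "M \<ge> 0" unfolding M_def using B(1) by (rule sum_nonneg)
  have M: "norm (u z - u a) \<le> M * \<epsilon>" if u: "adm u \<epsilon>" and z: "z \<in> \<Omega>" for u \<epsilon> z
  proof -
    obtain p where p: "p \<in> P" "z \<in> ball p (r p)" using z P(3) closure_subset by blast
    have "norm (u z - u a) \<le> B p * \<epsilon>" using B(2)[OF p(1) u] p(2) z by blast
    also have "\<dots> \<le> M * \<epsilon>"
      unfolding M_def using B(1) P(1) by (intro mult_right_mono pos[OF u] member_le_sum p(1)) auto
    finally show ?thesis .
  qed
  obtain \<delta> where \<delta>: "\<delta> > 0" "\<And>x. x \<in> closure \<Omega> \<Longrightarrow> \<exists>G\<in>(\<lambda>p. ball p (r p)) ` P. ball x \<delta> \<subseteq> G"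
    using Heine_Borel_lemma[OF comp P(3)] by (metis (no_types, lifting) imageE open_ball)
  show thesis
  proof (rule that[of "7 + 2 * M / \<delta>"])
    show "7 + 2 * M / \<delta> \<ge> 0" using M0 \<delta>(1) by simp
    fix u \<epsilon> z w
    assume u: "u holomorphic_on \<Omega>" "\<And>x. x \<in> \<Omega> \<Longrightarrow> norm (deriv u x) \<le> \<epsilon>"
      and zw: "z \<in> \<Omega>" "w \<in> \<Omega>"
    have ad: "adm u \<epsilon>" using u by (simp add: adm_def)
    note \<epsilon>0 = pos[OF ad]
    show "norm (u z - u w) \<le> (7 + 2 * M / \<delta>) * \<epsilon> * norm (z - w)"
    proof (cases "dist z w < \<delta>")
      case True
      obtain p where p: "p \<in> P" "ball z \<delta> \<subseteq> ball p (r p)"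
        using \<delta>(2) zw(1) closure_subset by blast
      have "z \<in> ball z \<delta>" "w \<in> ball z \<delta>" using True \<delta>(1) by auto
      then have "z \<in> \<Omega> \<inter> ball p (r p)" "w \<in> \<Omega> \<inter> ball p (r p)"
        using p(2) zw by blast+
      then have "norm (u z - u w) \<le> 7 * \<epsilon> * norm (z - w)"
        using r(2) ad p(1) P(2) by blast
      also have "\<dots> \<le> (7 + 2 * M / \<delta>) * \<epsilon> * norm (z - w)"
        using M0 \<delta>(1) \<epsilon>0 by (intro mult_right_mono) auto
      finally show ?thesis .
    next
      case False
      have "norm (u z - u w) \<le> norm (u z - u a) + norm (u w - u a)"
        using norm_triangle_ineq4[of "u z - u a" "u w - u a"] by simp
      also have "\<dots> \<le> 2 * M * \<epsilon>" using M[OF ad zw(1)] M[OF ad zw(2)] by simp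
      also have "\<dots> = 2 * M / \<delta> * \<epsilon> * \<delta>" using \<delta>(1) by simp
      also have "\<dots> \<le> (7 + 2 * M / \<delta>) * \<epsilon> * norm (z - w)"
        using False M0 \<delta>(1) \<epsilon>0 by (intro mult_mono) (auto simp: dist_norm)
      finally show ?thesis .
    qed
  qed
qed

section \<open>A quantitative form of injectivity\<close>

text \<open>Injectivity on the open \<open>U\<close> makes the derivative nonzero on
  \<open>K\<close>, which bounds difference quotients from below near the diagonal. Away from the
  diagonal, compactness and injectivity give the bound.\<close>

lemma injective_holomorphic_lower_bound:
  assumes "open U" "compact K" "K \<subseteq> U" "f holomorphic_on U" "inj_on f U"
  obtains c where "c > 0" "\<And>z w. z \<in> K \<Longrightarrow> w \<in> K \<Longrightarrow> c * norm (z - w) \<le> norm (f z - f w)"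
proof (cases "K = {}")
  case True
  then show thesis using that[of 1] by simp
next
  case False
  have hd: "deriv f holomorphic_on U" using assms holomorphic_deriv by blast
  have contK: "continuous_on K (\<lambda>z. norm (deriv f z))"
    using holomorphic_on_imp_continuous_on[OF hd] assms(3) continuous_on_subset
    by (intro continuous_intros) blast
  obtain x0 where x0: "x0 \<in> K" "\<And>x. x \<in> K \<Longrightarrow> norm (deriv f x0) \<le> norm (deriv f x)"
    using continuous_attains_inf[OF assms(2) False contK] by blast
  define m where "m = norm (deriv f x0)"
  have "deriv f x0 \<noteq> 0"
    using holomorphic_injective_imp_regular assms x0(1) by blast
  then have m: "m > 0" by (simp add: m_def)
  have "\<forall>p\<in>K. \<exists>r>0. ball p r \<subseteq> U \<and> (\<forall>z\<in>ball p r. norm (deriv f z - deriv f p) \<le> m / 2)"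
  proof
    fix p assume "p \<in> K"
    then have pU: "p \<in> U" using assms by blast
    obtain r1 where r1: "r1 > 0" "ball p r1 \<subseteq> U" using assms(1) pU open_contains_ball by blast
    have "isCont (deriv f) p"
      using holomorphic_on_imp_continuous_on[OF hd] assms(1) pU continuous_on_eq_continuous_at by blast
    then obtain r2 where r2: "r2 > 0" "\<And>z. dist z p < r2 \<Longrightarrow> dist (deriv f z) (deriv f p) < m / 2"
      unfolding continuous_at_eps_delta using m by (meson half_gt_zero)
    show "\<exists>r>0. ball p r \<subseteq> U \<and> (\<forall>z\<in>ball p r. norm (deriv f z - deriv f p) \<le> m / 2)"
    proof (intro exI[of _ "min r1 r2"] conjI ballI)
      fix z assume "z \<in> ball p (min r1 r2)"
      then show "norm (deriv f z - deriv f p) \<le> m / 2"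
        using r2(2)[of z] by (simp add: dist_commute flip: dist_norm)
    qed (use r1 r2 in auto)
  qed
  then obtain r where r: "\<And>p. p \<in> K \<Longrightarrow> r p > 0" "\<And>p. p \<in> K \<Longrightarrow> ball p (r p) \<subseteq> U"
    "\<And>p z. p \<in> K \<Longrightarrow> z \<in> ball p (r p) \<Longrightarrow> norm (deriv f z - deriv f p) \<le> m / 2"
    unfolding bchoice_iff by blast
  have local: "m / 2 * norm (z - w) \<le> norm (f z - f w)"
    if p: "p \<in> K" and zw: "z \<in> ball p (r p)" "w \<in> ball p (r p)" for p z w
  proof -
    \<comment> \<open>Subtracting the linear part at \<open>p\<close> leaves a function with
      derivative at most \<open>m / 2\<close>, while the linear part multiplies distances by at
      least \<open>m\<close>.\<close>
    have "norm ((f z - deriv f p * z) - (f w - deriv f p * w)) \<le> m / 2 * norm (z - w)"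
    proof (rule field_differentiable_bound[where S = "ball p (r p)"])
      fix x assume x: "x \<in> ball p (r p)"
      then have "x \<in> U" using r(2)[OF p] by blast
      then show "((\<lambda>z. f z - deriv f p * z) has_field_derivative deriv f x - deriv f p)
          (at x within ball p (r p))"
        by (intro DERIV_diff DERIV_cmult_Id holomorphic_derivI[OF assms(4,1)])
      show "norm (deriv f x - deriv f p) \<le> m / 2" using r(3)[OF p x] .
    qed (use zw in auto)
    moreover have "(f z - deriv f p * z) - (f w - deriv f p * w) = (f z - f w) - deriv f p * (z - w)"
      by (simp add: algebra_simps)
    moreover have "m * norm (z - w) \<le> norm (deriv f p * (z - w))"
      using x0(2)[OF p] by (simp add: norm_mult m_def mult_right_mono)
    ultimately show ?thesis
      using norm_triangle_ineq2[of "deriv f p * (z - w)" "f z - f w"]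
      by (simp add: norm_minus_commute)
  qed
  obtain \<delta> where \<delta>: "\<delta> > 0" "\<And>x. x \<in> K \<Longrightarrow> \<exists>G\<in>(\<lambda>p. ball p (r p)) ` K. ball x \<delta> \<subseteq> G"
    by (rule Heine_Borel_lemma[OF assms(2), of "(\<lambda>p. ball p (r p)) ` K"]) (use r(1) in auto)
  \<comment> \<open>Pairs whose distance is at least the Lebesgue number of the cover by local
    balls; closer pairs share a ball.\<close>
  define Q where "Q = K \<times> K \<inter> {x. \<delta> \<le> dist (fst x) (snd x)}"
  have Q: "compact Q" unfolding Q_def
    by (intro compact_Int_closed compact_Times assms(2) closed_Collect_le continuous_intros)
  have imQ: "fst ` Q \<subseteq> U" "snd ` Q \<subseteq> U" using assms(3) by (auto simp: Q_def)
  note contf = holomorphic_on_imp_continuous_on[OF assms(4)]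
  have contQ: "continuous_on Q (\<lambda>x. norm (f (fst x) - f (snd x)))"
    by (intro continuous_on_norm continuous_on_diff continuous_on_compose2[OF contf _ imQ(1)]
        continuous_on_compose2[OF contf _ imQ(2)] continuous_on_fst continuous_on_snd continuous_on_id)
  obtain \<mu> where \<mu>: "\<mu> > 0" "\<And>z w. (z, w) \<in> Q \<Longrightarrow> \<mu> \<le> norm (f z - f w)"
  proof (cases "Q = {}")
    case True
    then show thesis using that[of 1] by simp
  next
    case False
    obtain x where x: "x \<in> Q" "\<And>y. y \<in> Q \<Longrightarrow> norm (f (fst x) - f (snd x)) \<le> norm (f (fst y) - f (snd y))"
      using continuous_attains_inf[OF Q False contQ] by blast
    have "fst x \<noteq> snd x" "fst x \<in> U" "snd x \<in> U" using x(1) \<delta>(1) assms(3) by (auto simp: Q_def)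
    then have "f (fst x) \<noteq> f (snd x)" using assms(5) by (auto simp: inj_on_def)
    then show thesis using that[of "norm (f (fst x) - f (snd x))"] x(2) by force
  qed
  obtain D where D: "D > 0" "\<And>x. x \<in> K \<Longrightarrow> norm x \<le> D"
    using compact_imp_bounded[OF assms(2)] bounded_pos by blast
  show thesis
  \<comment> \<open>Two points of \<open>K\<close> are at most \<open>2 * D\<close> apart, so \<mu>
    divided by this bounds the difference quotients of far pairs.\<close>
  proof (rule that[of "min (m / 2) (\<mu> / (2 * D))"])
    show "min (m / 2) (\<mu> / (2 * D)) > 0" using m \<mu>(1) D(1) by simp
    fix z w assume zw: "z \<in> K" "w \<in> K"
    show "min (m / 2) (\<mu> / (2 * D)) * norm (z - w) \<le> norm (f z - f w)"
    proof (cases "dist z w < \<delta>")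
      case True
      obtain p where p: "p \<in> K" "ball z \<delta> \<subseteq> ball p (r p)" using \<delta>(2)[OF zw(1)] by blast
      have "z \<in> ball z \<delta>" "w \<in> ball z \<delta>" using True \<delta>(1) by auto
      then have "m / 2 * norm (z - w) \<le> norm (f z - f w)"
        using p(2) by (intro local[OF p(1)]) blast+
      moreover have "min (m / 2) (\<mu> / (2 * D)) * norm (z - w) \<le> m / 2 * norm (z - w)"
        by (intro mult_right_mono) auto
      ultimately show ?thesis by linarith
    next
      case False
      have "norm (z - w) \<le> 2 * D" using D(2)[OF zw(1)] D(2)[OF zw(2)] norm_triangle_ineq4[of z w] by linarith
      then have "min (m / 2) (\<mu> / (2 * D)) * norm (z - w) \<le> \<mu> / (2 * D) * (2 * D)"
        using \<mu>(1) D(1) m by (intro mult_mono) auto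
      also have "\<dots> = \<mu>" using D(1) by simp
      also have "\<mu> \<le> norm (f z - f w)" using False zw by (intro \<mu>(2)) (simp add: Q_def)
      finally show ?thesis .
    qed
  qed
qed

section \<open>The straight-line homotopy\<close>

theorem theorem6p6:
  fixes \<Omega> :: "complex set" and f :: "complex \<Rightarrow> complex"
  assumes "smooth_bounded_domain \<Omega>"
    and "\<exists>U. open U \<and> closure \<Omega> \<subseteq> U \<and> univalent_on f U"
    and "quadrature_domain (f ` \<Omega>)"
  shows "\<exists>\<epsilon>::real>0. \<forall>g :: complex \<Rightarrow> complex.
           g holomorphic_on \<Omega> \<and>
           (SUP z\<in>\<Omega>. ereal (norm (deriv g z - deriv f z))) < ereal \<epsilon> \<and>
           quadrature_domain (g ` \<Omega>) \<longrightarrow>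
           (\<forall>t\<in>{0..1::real}.
              biholomorphic_onto_image (\<lambda>z. (1 - of_real t) * f z + of_real t * g z) \<Omega> \<and>
              quadrature_domain ((\<lambda>z. (1 - of_real t) * f z + of_real t * g z) ` \<Omega>))"
proof -
  have dom: "planar_domain \<Omega>" and op: "open \<Omega>" and bd: "bounded \<Omega>"
    using assms(1) by (auto simp: smooth_bounded_domain_def planar_domain_def)
  obtain U where U: "open U" "closure \<Omega> \<subseteq> U" "f holomorphic_on U" "inj_on f U"
    using assms(2) unfolding univalent_on_def by blast
  have sub: "\<Omega> \<subseteq> U" using U(2) closure_subset by blast
  have holf: "f holomorphic_on \<Omega>" and injf: "inj_on f \<Omega>"
    using U sub holomorphic_on_subset inj_on_subset by blast+
  obtain L where L: "L \<ge> 0" "\<And>u \<epsilon> z w. \<lbrakk>u holomorphic_on \<Omega>; \<And>x. x \<in> \<Omega> \<Longrightarrow> norm (deriv u x) \<le> \<epsilon>;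
      z \<in> \<Omega>; w \<in> \<Omega>\<rbrakk> \<Longrightarrow> norm (u z - u w) \<le> L * \<epsilon> * norm (z - w)"
    using smooth_bounded_domain_Lipschitz[OF assms(1)] by blast
  obtain c where c: "c > 0"
    "\<And>z w. z \<in> closure \<Omega> \<Longrightarrow> w \<in> closure \<Omega> \<Longrightarrow> c * norm (z - w) \<le> norm (f z - f w)"
    using injective_holomorphic_lower_bound[OF U(1) _ U(2-4)] bd by (auto simp: compact_closure)
  \<comment> \<open>The summand 1 makes \<open>L * \<epsilon> < c\<close> strict and avoids division
    by zero when \<open>L = 0\<close>.\<close>
  define \<epsilon> where "\<epsilon> = c / (L + 1)"
  have \<epsilon>: "\<epsilon> > 0" "L * \<epsilon> < c" using L(1) c(1) by (auto simp: \<epsilon>_def field_simps)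
  show ?thesis
  proof (intro exI[of _ \<epsilon>] conjI allI impI ballI \<epsilon>(1))
    fix g :: "complex \<Rightarrow> complex" and t :: real
    assume g: "g holomorphic_on \<Omega> \<and> (SUP z\<in>\<Omega>. ereal (norm (deriv g z - deriv f z))) < ereal \<epsilon> \<and>
      quadrature_domain (g ` \<Omega>)" and t: "t \<in> {0..1}"
    define \<phi> where "\<phi> = (\<lambda>t::real. \<lambda>z. (1 - of_real t) * f z + of_real t * g z)"
    have holg: "g holomorphic_on \<Omega>" using g by blast
    have close: "norm (deriv g z - deriv f z) \<le> \<epsilon>" if "z \<in> \<Omega>" for z
    proof -
      have "ereal (norm (deriv g z - deriv f z)) \<le> (SUP z\<in>\<Omega>. ereal (norm (deriv g z - deriv f z)))"
        using that by (intro SUP_upper)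
      also have "\<dots> < ereal \<epsilon>" using g by blast
      finally show ?thesis by simp
    qed
    have diff: "norm ((g z - f z) - (g w - f w)) \<le> L * \<epsilon> * norm (z - w)"
      if "z \<in> \<Omega>" "w \<in> \<Omega>" for z w
    proof (rule L(2)[OF _ _ that])
      show "(\<lambda>z. g z - f z) holomorphic_on \<Omega>" by (intro holomorphic_intros holf holg)
      fix x assume x: "x \<in> \<Omega>"
      have "deriv (\<lambda>z. g z - f z) x = deriv g x - deriv f x"
        by (rule DERIV_imp_deriv) (intro derivative_intros holomorphic_derivI[OF holg op x] holomorphic_derivI[OF holf op x])
      then show "norm (deriv (\<lambda>z. g z - f z) x) \<le> \<epsilon>" using close[OF x] by simp
    qed
    have hol: "\<phi> t holomorphic_on \<Omega>" for t
      unfolding \<phi>_def by (intro holomorphic_intros holf holg)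
    \<comment> \<open>Proved for every parameter in the interval, because the value 1 yields the
      injectivity of \<open>g\<close>.\<close>
    have inj: "inj_on (\<phi> t) \<Omega>" if t: "t \<in> {0..1}" for t
    proof (rule inj_onI, rule ccontr)
      fix z w assume zw: "z \<in> \<Omega>" "w \<in> \<Omega>" and eq: "\<phi> t z = \<phi> t w" and "z \<noteq> w"
      then have n: "norm (z - w) > 0" by simp
      \<comment> \<open>Equal values mean that the increment of \<open>f\<close> is cancelled by
        \<open>t\<close> times that of \<open>g - f\<close>, whose Lipschitz constant is below
        \<open>c\<close>.\<close>
      have "f z - f w = - (of_real t * ((g z - f z) - (g w - f w)))"
        using eq by (simp add: \<phi>_def algebra_simps)
      then have "norm (f z - f w) = t * norm ((g z - f z) - (g w - f w))"
        using t by (simp add: norm_mult)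
      also have "\<dots> \<le> norm ((g z - f z) - (g w - f w))"
        using t by (intro mult_left_le_one_le) auto
      also have "\<dots> \<le> L * \<epsilon> * norm (z - w)" by (rule diff[OF zw])
      also have "\<dots> < c * norm (z - w)" using n \<epsilon>(2) by (rule mult_strict_right_mono[rotated])
      also have "\<dots> \<le> norm (f z - f w)" using c(2) zw closure_subset by blast
      finally show False by simp
    qed
    have dphi: "deriv (\<phi> t) z = of_real (1 - t) * deriv f z + of_real t * deriv g z" if "z \<in> \<Omega>" for z
      unfolding \<phi>_def
      by (rule DERIV_imp_deriv)
        (auto intro!: derivative_eq_intros holomorphic_derivI[OF holg op that] holomorphic_derivI[OF holf op that])
    have injg: "inj_on g \<Omega>" using inj[of 1] by (simp add: \<phi>_def inj_on_def)
    have "quadrature_weight \<Omega> (deriv f)" "quadrature_weight \<Omega> (deriv g)"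
      using assms(3) g quadrature_domain_image_iff[OF dom] holf injf holg injg by blast+
    \<comment> \<open>The linear step: \<open>deriv (\<phi> t)\<close> is a real combination of the
      two weights \<open>deriv f\<close> and \<open>deriv g\<close>.\<close>
    then have "quadrature_weight \<Omega> (deriv (\<phi> t))"
      by (intro quadrature_weight_cong[OF op quadrature_weight_add_real dphi])
    then have qd: "quadrature_domain (\<phi> t ` \<Omega>)"
      using quadrature_domain_image_iff[OF dom hol inj[OF t]] by blast
    obtain G where G: "G holomorphic_on \<phi> t ` \<Omega>" "\<And>z. z \<in> \<Omega> \<Longrightarrow> G (\<phi> t z) = z"
      using holomorphic_has_inverse[OF hol op inj[OF t]] by metis
    have "inv_into \<Omega> (\<phi> t) holomorphic_on \<phi> t ` \<Omega>"
      using G(1) by (rule holomorphic_transform) (use G(2) inj[OF t] in \<open>auto simp: inv_into_f_f\<close>)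
    then have "biholomorphic_onto_image (\<phi> t) \<Omega>"
      unfolding biholomorphic_onto_image_def
      using hol inj[OF t] open_mapping_thm3[OF hol op inj[OF t]] by blast
    with qd show "biholomorphic_onto_image (\<lambda>z. (1 - of_real t) * f z + of_real t * g z) \<Omega>"
      "quadrature_domain ((\<lambda>z. (1 - of_real t) * f z + of_real t * g z) ` \<Omega>)"
      unfolding \<phi>_def by blast+
  qed
qed

end
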